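(* Fix a compact group $G$ acting on $\mathcal{X}$ with $\mu_{\mathcal{X}}$ a $G$-invariant probability measure. Let $\mathcal{A}$ be a $G$-equivariant noisy gradient descent algorithm corresponding to a parametric model $f(\cdot;\theta)$. Fix any target function $h:\mathcal{X}\to\{-1,1\}$ and any baseline function $h_*:\mathcal{X}\to\{-1,1\}$ satisfying $h_*\circ g=h_*$ for all $g\in G$. For any $T\in\mathbb{Z}_{\ge1}$, $\tau>0$, $R>0$ and $\varepsilon>0$, $$\mathbb{P}_{\theta_T}\left[\|f(\cdot;\theta_h^T)-h\|_2^2\le\|h_*-h\|_2^2-\varepsilon\right]\le\frac{R}{2\tau}\sqrt{T\mathrm{A}}+\frac{\mathrm{A}}{\varepsilon},$$ where $\mathrm{A}=\mathrm{A}(h,G;h_* )$ and $\theta_h^T$ denotes the parameters after $T$ steps with target $h$.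
   Context: $\|\cdot\|_2,\langle\cdot,\cdot\rangle$ refer to $L^2(\mu_{\mathcal{X}})$; $U_gh=h\circ g$; $\mu_G$ is Haar probability measure on $G$; $\mathrm{A}(h,G;h_* )=\sup_{\|\phi\|_2=1}\mathbb{E}_{g\sim\mu_G}[|\langle U_gh-h_*,\phi\rangle|^2]$. Noisy gradient descent: $\mathcal{X}\subseteq\mathbb{R}^D$, model $f(\cdot;\theta)$, $\theta\in\mathbb{R}^\eta$, with $\nabla_\theta f(x;\theta)$ existing for a.e. $x,\theta$; initialization $\theta_0\sim\mu_0$; updates $\theta_{k+1}=\theta_k-\eta_k(G_h(\theta_k)+\xi_k)$, $\eta_k>0$, $\xi_k\sim N(0,\tau^2I)$ i.i.d., with $G_h(\theta)=-\mathbb{E}_{x\sim\mu_{\mathcal{X}}}[(h(x)-f(x;\theta))\Pi_R\nabla_\theta f(x;\theta)]$, $\Pi_R$ the projection onto the ball of radius $R$. The algorithm (mapping the law $\mathcal{D}$ of $(x,h(x))$ to the random output $f(\cdot;\theta_T)$) is $G$-equivariant if $\mathcal{A}(\mathcal{D})\overset{d}{=}\mathcal{A}(g\circ\mathcal{D})\circ g$ for all $g$, where $g\circ\mathcal{D}$ is the law of $(g(x),y)$. The probability is over initialization and noise. *)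

theory Defs
  imports "HOL-Probability.Probability" "HOL-Algebra.Group_Action"
begin

subsection \<open>Square-integrable real functions\<close>

definition L2 :: "'a measure \<Rightarrow> ('a \<Rightarrow> real) set" where
  "L2 M = {u \<in> borel_measurable M. integrable M (\<lambda>x. (u x)\<^sup>2)}"

definition L2_inner :: "'a measure \<Rightarrow> ('a \<Rightarrow> real) \<Rightarrow> ('a \<Rightarrow> real) \<Rightarrow> real" where
  "L2_inner M u v = (LINT x|M. u x * v x)"

text \<open>Meaningful only on \<open>L2 M\<close>: the Bochner integral is 0 for non-integrable functions.\<close>

definition L2_norm :: "'a measure \<Rightarrow> ('a \<Rightarrow> real) \<Rightarrow> real" where
  "L2_norm M u = sqrt (L2_inner M u u)"


subsection \<open>Compact groups, Haar measure, and the alignment\<close>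

definition compact_group :: "('g, 'm) monoid_scheme \<Rightarrow> 'g topology \<Rightarrow> bool" where
  "compact_group G \<O> \<longleftrightarrow>
     group G \<and> topspace \<O> = carrier G \<and>
     continuous_map (prod_topology \<O> \<O>) \<O> (\<lambda>(a, b). a \<otimes>\<^bsub>G\<^esub> b) \<and>
     continuous_map \<O> \<O> (\<lambda>a. inv\<^bsub>G\<^esub> a) \<and>
     compact_space \<O> \<and> Hausdorff_space \<O>"

definition borel_of_topology :: "'g topology \<Rightarrow> 'g measure" where
  "borel_of_topology \<O> = sigma (topspace \<O>) {U. openin \<O> U}"

text \<open>Left-invariant regular Borel probability measure; regularity is what makes it unique
  when the group is not metrizable.\<close>

definition haar_prob_measure ::
    "('g, 'm) monoid_scheme \<Rightarrow> 'g topology \<Rightarrow> 'g measure \<Rightarrow> bool" where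
  "haar_prob_measure G \<O> \<nu> \<longleftrightarrow>
     prob_space \<nu> \<and> sets \<nu> = sets (borel_of_topology \<O>) \<and>
     (\<forall>g\<in>carrier G. \<forall>B\<in>sets \<nu>. emeasure \<nu> (g <#\<^bsub>G\<^esub> B) = emeasure \<nu> B) \<and>
     (\<forall>B\<in>sets \<nu>. emeasure \<nu> B = (INF U\<in>{U. openin \<O> U \<and> B \<subseteq> U}. emeasure \<nu> U)) \<and>
     (\<forall>U. openin \<O> U \<longrightarrow> emeasure \<nu> U = (SUP K\<in>{K. compactin \<O> K \<and> K \<subseteq> U}. emeasure \<nu> K))"

definition alignment ::
    "'g measure \<Rightarrow> 'x measure \<Rightarrow> ('g \<Rightarrow> 'x \<Rightarrow> 'x) \<Rightarrow> ('x \<Rightarrow> real) \<Rightarrow> ('x \<Rightarrow> real) \<Rightarrow> real" where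
  "alignment \<nu> \<mu> act h h0 =
     (SUP \<phi>\<in>{\<phi> \<in> L2 \<mu>. L2_norm \<mu> \<phi> = 1}.
        LINT g|\<nu>. \<bar>L2_inner \<mu> (\<lambda>x. h (act g x) - h0 x) \<phi>\<bar>\<^sup>2)"


subsection \<open>Noisy gradient descent\<close>

text \<open>\<open>f x \<theta>\<close> is the model and \<open>f' x \<theta>\<close> its gradient in \<open>\<theta>\<close>. The gradient only has to exist almost
  everywhere; at the exceptional points \<open>f'\<close> may take any value (for instance the convention used
  for the derivative of a ReLU at its kink).\<close>

definition parametric_model ::
    "'x measure \<Rightarrow> ('x \<Rightarrow> 'p::euclidean_space \<Rightarrow> real) \<Rightarrow> ('x \<Rightarrow> 'p \<Rightarrow> 'p) \<Rightarrow> bool" where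
  "parametric_model \<mu> f f' \<longleftrightarrow>
     (\<lambda>(x, \<theta>). f x \<theta>) \<in> borel_measurable (\<mu> \<Otimes>\<^sub>M borel) \<and>
     (\<lambda>(x, \<theta>). f' x \<theta>) \<in> borel_measurable (\<mu> \<Otimes>\<^sub>M borel) \<and>
     (AE (x, \<theta>) in \<mu> \<Otimes>\<^sub>M lborel. GDERIV (f x) \<theta> :> f' x \<theta>)"

definition isotropic_gaussian :: "real \<Rightarrow> 'p::euclidean_space measure" where
  "isotropic_gaussian \<tau> =
     density lborel (\<lambda>z. ennreal (\<Prod>b\<in>Basis. normal_density 0 \<tau> (z \<bullet> b)))"

definition population_gradient ::
    "('x \<Rightarrow> 'p::euclidean_space \<Rightarrow> real) \<Rightarrow> ('x \<Rightarrow> 'p \<Rightarrow> 'p) \<Rightarrow> real \<Rightarrow> ('x \<times> real) measure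
     \<Rightarrow> 'p \<Rightarrow> 'p" where
  "population_gradient f f' R D \<theta> =
     - (LINT z|D. (snd z - f (fst z) \<theta>) *\<^sub>R closest_point (cball 0 R) (f' (fst z) \<theta>))"

primrec gd_iterate ::
    "('x \<Rightarrow> 'p::euclidean_space \<Rightarrow> real) \<Rightarrow> ('x \<Rightarrow> 'p \<Rightarrow> 'p) \<Rightarrow> real \<Rightarrow> (nat \<Rightarrow> real)
     \<Rightarrow> ('x \<times> real) measure \<Rightarrow> 'p \<times> (nat \<Rightarrow> 'p) \<Rightarrow> nat \<Rightarrow> 'p" where
  "gd_iterate f f' R \<eta> D \<omega> 0 = fst \<omega>"
| "gd_iterate f f' R \<eta> D \<omega> (Suc k) =
     gd_iterate f f' R \<eta> D \<omega> k
       - \<eta> k *\<^sub>R (population_gradient f f' R D (gd_iterate f f' R \<eta> D \<omega> k) + snd \<omega> k)"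

text \<open>The joint law of the initialization and of the i.i.d. noise sequence.\<close>

definition gd_randomness ::
    "'p::euclidean_space measure \<Rightarrow> real \<Rightarrow> ('p \<times> (nat \<Rightarrow> 'p)) measure" where
  "gd_randomness \<mu>0 \<tau> = \<mu>0 \<Otimes>\<^sub>M (\<Pi>\<^sub>M k\<in>UNIV. isotropic_gaussian \<tau>)"

text \<open>The law of the output \<open>f(\<cdot>; \<theta>\<^sub>T)\<close> as a random function on \<open>X\<close>. Laws of random functions live on
  the product sigma-algebra, so equality in distribution means equality of all
  finite-dimensional distributions.\<close>

definition gd_algorithm ::
    "'x set \<Rightarrow> ('x \<Rightarrow> 'p::euclidean_space \<Rightarrow> real) \<Rightarrow> ('x \<Rightarrow> 'p \<Rightarrow> 'p) \<Rightarrow> 'p measure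
     \<Rightarrow> (nat \<Rightarrow> real) \<Rightarrow> real \<Rightarrow> real \<Rightarrow> nat \<Rightarrow> ('x \<times> real) measure \<Rightarrow> ('x \<Rightarrow> real) measure" where
  "gd_algorithm X f f' \<mu>0 \<eta> \<tau> R T D =
     distr (gd_randomness \<mu>0 \<tau>) (\<Pi>\<^sub>M x\<in>X. borel)
       (\<lambda>\<omega>. \<lambda>x\<in>X. f x (gd_iterate f f' R \<eta> D \<omega> T))"

definition data_law :: "'x measure \<Rightarrow> ('x \<Rightarrow> real) \<Rightarrow> ('x \<times> real) measure" where
  "data_law \<mu> h = distr \<mu> (\<mu> \<Otimes>\<^sub>M borel) (\<lambda>x. (x, h x))"

text \<open>\<open>\<A>(D) = \<A>(g \<circ> D) \<circ> g\<close> in distribution, for every \<open>g\<close> and every law \<open>D\<close> of \<open>(x, h x)\<close> with a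
  binary target \<open>h\<close>, where \<open>g \<circ> D\<close> is the law of \<open>(g x, y)\<close>.\<close>

definition equivariant_algorithm ::
    "('g, 'm) monoid_scheme \<Rightarrow> 'x measure \<Rightarrow> ('g \<Rightarrow> 'x \<Rightarrow> 'x)
     \<Rightarrow> (('x \<times> real) measure \<Rightarrow> ('x \<Rightarrow> real) measure) \<Rightarrow> bool" where
  "equivariant_algorithm G \<mu> act \<A> \<longleftrightarrow>
     (\<forall>h \<in> borel_measurable \<mu> \<inter> (space \<mu> \<rightarrow> {-1, 1}). \<forall>g\<in>carrier G.
        let D = data_law \<mu> h;
            gD = distr D (\<mu> \<Otimes>\<^sub>M borel) (\<lambda>(x, y). (act g x, y))
        in \<A> D = distr (\<A> gD) (\<Pi>\<^sub>M x\<in>space \<mu>. borel) (\<lambda>F. \<lambda>x\<in>space \<mu>. F (act g x)))"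

lemma population_gradient_data_law:
  assumes f: "parametric_model \<mu> f f'" and h: "h \<in> borel_measurable \<mu>" and "R > 0"
  shows "population_gradient f f' R (data_law \<mu> h) \<theta> =
    - (LINT x|\<mu>. (h x - f x \<theta>) *\<^sub>R closest_point (cball 0 R) (f' x \<theta>))"
proof -
  have p: "closest_point (cball (0::'b) R) \<in> borel_measurable borel"
    using assms(3) by (intro borel_measurable_continuous_onI continuous_on_closest_point) auto
  have pair: "(\<lambda>x. (x, \<theta>)) \<in> \<mu> \<rightarrow>\<^sub>M \<mu> \<Otimes>\<^sub>M borel"
    by measurable
  have fm: "(\<lambda>x. f x \<theta>) \<in> borel_measurable \<mu>"
    using f measurable_compose[OF pair, of "\<lambda>(x, \<theta>). f x \<theta>" borel]
    unfolding parametric_model_def by simp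
  have fm': "(\<lambda>x. f' x \<theta>) \<in> borel_measurable \<mu>"
    using f measurable_compose[OF pair, of "\<lambda>(x, \<theta>). f' x \<theta>" borel]
    unfolding parametric_model_def by simp
  note [measurable] = p fm fm' h
  have "(\<lambda>z. (snd z - f (fst z) \<theta>) *\<^sub>R closest_point (cball 0 R) (f' (fst z) \<theta>))
      \<in> borel_measurable (\<mu> \<Otimes>\<^sub>M borel)"
    by measurable
  then show ?thesis
    unfolding population_gradient_def data_law_def using h
    by (subst integral_distr) (auto simp: measurable_Pair)
qed

end

theory Submission
  imports Defs
begin

text \<open>By equivariance, training on \<open>h\<close> succeeds exactly as often as training on \<open>h \<circ> g\<close>, for every \<open>g\<close>.
  Replace the trajectory trained on \<open>h \<circ> g\<close> by the one trained on \<open>h0\<close>. Pinsker's inequality and the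
  chain rule for Gaussian steps bound the cost by the squared differences of the population gradients
  along the \<open>h0\<close>-trajectory, which does not depend on \<open>g\<close>; averaged over \<open>g\<close>, these differences are
  controlled by the alignment. A parameter of the \<open>h0\<close>-trajectory that fits \<open>h \<circ> g\<close> better than \<open>h0\<close>
  does by a margin \<open>\<epsilon>\<close> yields a unit vector with squared correlation at least \<open>\<epsilon>\<close> with
  \<open>h \<circ> g - h0\<close>, so by Markov's inequality it does so for a set of \<open>g\<close> of measure at most
  alignment\<open>/\<epsilon>\<close>.\<close>

subsection \<open>Gaussian shifts\<close>

text \<open>The constant: averaged over \<open>g\<close>, each of the \<open>T\<close> steps costs
  relative entropy at most \<open>A * R\<^sup>2 / (2 * \<tau>\<^sup>2)\<close>, where
  \<open>A\<close> is the alignment; the root of half the total is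
  \<open>R / (2 * \<tau>) * sqrt (T * A)\<close>. Step sizes cancel because a step scales gradient
  and noise alike. The dimension of the parameter cancels because the squared coordinates of a
  clipped gradient sum to at most \<open>R\<^sup>2\<close>.

  The relative entropy is that of the \<open>h0\<close>-law with respect to the law trained on
  \<open>h \<circ> g\<close>, so its integrand is averaged over the \<open>h0\<close>-trajectory.
  Fubini then fixes the parameter first and averages over \<open>g\<close> inside, which is the form
  the alignment controls.

  The obstacle in using equivariance: it equates finite-dimensional distributions, whereas success
  is an integral over all \<open>x\<close>. Joint measurability of the model bridges the gap:
  moments of the truncated loss are, by Fubini, integrals of finite-dimensional expectations, and
  the moments of a bounded variable determine its law.\<close>

lemma (in prob_space) expectation_le_ln_expectation_exp:
  fixes f :: "'a \<Rightarrow> real"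
  assumes f: "integrable M f" and exp: "integrable M (\<lambda>x. exp (f x))"
  shows "expectation f \<le> ln (expectation (\<lambda>x. exp (f x)))"
proof -
  \<comment> \<open>Jensen's inequality for the exponential, by its tangent:
    \<open>1 + y \<le> exp y\<close> is integrated at
    \<open>y = f x - expectation f\<close>.\<close>
  have "1 = expectation (\<lambda>x. 1 + (f x - expectation f))"
    using f by (simp add: prob_space)
  also have "\<dots> \<le> expectation (\<lambda>x. exp (- expectation f) * exp (f x))"
  proof (rule integral_mono)
    show "1 + (f x - expectation f) \<le> exp (- expectation f) * exp (f x)" for x
      using exp_ge_add_one_self[of "f x - expectation f"] by (simp flip: exp_add)
  qed (use f exp in auto)
  finally have "exp (expectation f) \<le> expectation (\<lambda>x. exp (f x))"
    by (simp add: exp_minus field_simps)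
  then show ?thesis
    by (metis exp_gt_zero exp_le_cancel_iff exp_ln less_le_trans)
qed

lemma isotropic_gaussian_altdef:
  fixes \<tau> :: real
  assumes "\<tau> > 0"
  shows "(isotropic_gaussian \<tau> :: 'p::euclidean_space measure) =
    density lborel (\<lambda>z. ennreal ((1 / sqrt (2 * pi * \<tau>\<^sup>2)) ^ DIM('p) * exp (- (norm z)\<^sup>2 / (2 * \<tau>\<^sup>2))))"
proof -
  have "(\<Prod>b\<in>Basis. normal_density 0 \<tau> (z \<bullet> b)) =
      (1 / sqrt (2 * pi * \<tau>\<^sup>2)) ^ DIM('p) * exp (- (norm z)\<^sup>2 / (2 * \<tau>\<^sup>2))" for z :: 'p
  proof -
    have "(norm z)\<^sup>2 = (\<Sum>b\<in>Basis. (z \<bullet> b)\<^sup>2)"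
      unfolding power2_norm_eq_inner by (subst euclidean_inner) (simp add: power2_eq_square)
    then have "exp (- (norm z)\<^sup>2 / (2 * \<tau>\<^sup>2)) = (\<Prod>b\<in>Basis. exp (- (z \<bullet> b)\<^sup>2 / (2 * \<tau>\<^sup>2)))"
      by (simp add: sum_divide_distrib sum_negf flip: exp_sum)
    then show ?thesis
      unfolding normal_density_def prod.distrib by simp
  qed
  then show ?thesis
    by (simp add: isotropic_gaussian_def)
qed

lemma sets_isotropic_gaussian [simp, measurable_cong]: "sets (isotropic_gaussian \<tau>) = sets borel"
  by (simp add: isotropic_gaussian_def)

lemma space_isotropic_gaussian [simp]: "space (isotropic_gaussian \<tau>) = UNIV"
  by (simp add: isotropic_gaussian_def)

lemma prob_space_isotropic_gaussian:
  fixes \<tau> :: real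
  assumes "\<tau> > 0"
  shows "prob_space (isotropic_gaussian \<tau> :: 'p::euclidean_space measure)"
proof
  have "(\<integral>\<^sup>+ x. ennreal (normal_density 0 \<tau> x) \<partial>lborel) = 1"
    using assms by (subst nn_integral_eq_integral) auto
  then show "emeasure (isotropic_gaussian \<tau> :: 'p measure) (space (isotropic_gaussian \<tau>)) = 1"
    using nn_integral_lborel_prod[of "\<lambda>_::'p. \<lambda>x. ennreal (normal_density 0 \<tau> x)"]
    by (simp add: isotropic_gaussian_def emeasure_density prod_ennreal)
qed

text \<open>The Cameron-Martin formula: Lebesgue measure is translation invariant, and expanding the
  squared norm of \<open>d + z\<close> splits off the exponential weight. For nonnegative integrals
  no prior integrability of that weight is required; it is derived from this formula.\<close>

lemma nn_integral_isotropic_gaussian_shift: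
  fixes u :: "'p::euclidean_space \<Rightarrow> ennreal"
  assumes "\<tau> > 0" and [measurable]: "u \<in> borel_measurable borel"
  shows "(\<integral>\<^sup>+z. u z \<partial>isotropic_gaussian \<tau>) =
    (\<integral>\<^sup>+z. u (d + z) * ennreal (exp (- (2 * (z \<bullet> d) + (norm d)\<^sup>2) / (2 * \<tau>\<^sup>2))) \<partial>isotropic_gaussian \<tau>)"
proof -
  let ?C = "(1 / sqrt (2 * pi * \<tau>\<^sup>2)) ^ DIM('p)"
  have split: "?C * exp (- (norm (d + z))\<^sup>2 / (2 * \<tau>\<^sup>2)) =
      ?C * exp (- (norm z)\<^sup>2 / (2 * \<tau>\<^sup>2)) * exp (- (2 * (z \<bullet> d) + (norm d)\<^sup>2) / (2 * \<tau>\<^sup>2))" for z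
    by (simp add: power2_norm_eq_inner inner_add_left inner_add_right inner_commute
        add_divide_distrib diff_divide_distrib flip: exp_add mult.assoc)
  have "(\<integral>\<^sup>+z. u z \<partial>isotropic_gaussian \<tau>) =
      (\<integral>\<^sup>+z. ennreal (?C * exp (- (norm z)\<^sup>2 / (2 * \<tau>\<^sup>2))) * u z \<partial>distr lborel borel ((+) d))"
    using assms(1) by (simp add: isotropic_gaussian_altdef nn_integral_density lborel_distr_plus)
  also have "\<dots> = (\<integral>\<^sup>+z. ennreal (?C * exp (- (norm (d + z))\<^sup>2 / (2 * \<tau>\<^sup>2))) * u (d + z) \<partial>lborel)"
    by (subst nn_integral_distr) auto
  also have "\<dots> = (\<integral>\<^sup>+z. u (d + z) * ennreal (exp (- (2 * (z \<bullet> d) + (norm d)\<^sup>2) / (2 * \<tau>\<^sup>2))) \<partial>isotropic_gaussian \<tau>)"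
    unfolding split using assms(1)
    by (simp add: isotropic_gaussian_altdef nn_integral_density ennreal_mult mult_ac)
  finally show ?thesis .
qed

lemma integrable_exp_inner_isotropic_gaussian:
  fixes d :: "'p::euclidean_space"
  assumes "\<tau> > 0"
  shows "integrable (isotropic_gaussian \<tau>) (\<lambda>z. exp (z \<bullet> d))"
proof (rule integrableI_nonneg)
  interpret prob_space "isotropic_gaussian \<tau> :: 'p measure"
    by (rule prob_space_isotropic_gaussian[OF assms])
  \<comment> \<open>The shift \<open>e\<close> makes the linear part of the Cameron-Martin exponent
    equal to \<open>z \<bullet> d\<close>, and \<open>c\<close> cancels its constant part. The
    exponential moment is then \<open>c\<close> times the total mass 1.\<close>
  define e where "e = (- \<tau>\<^sup>2) *\<^sub>R d"
  define c where "c = exp ((norm e)\<^sup>2 / (2 * \<tau>\<^sup>2))"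
  have eq: "exp (z \<bullet> d) = c * exp (- (2 * (z \<bullet> e) + (norm e)\<^sup>2) / (2 * \<tau>\<^sup>2))" for z
    using assms unfolding c_def exp_add[symmetric] by (simp add: e_def field_simps)
  have "(\<integral>\<^sup>+z. ennreal (exp (z \<bullet> d)) \<partial>isotropic_gaussian \<tau>) = ennreal c *
     (\<integral>\<^sup>+z. 1 * ennreal (exp (- (2 * (z \<bullet> e) + (norm e)\<^sup>2) / (2 * \<tau>\<^sup>2))) \<partial>isotropic_gaussian \<tau>)"
    unfolding eq by (simp add: ennreal_mult c_def nn_integral_cmult)
  also have "\<dots> = ennreal c"
    using nn_integral_isotropic_gaussian_shift[OF assms, of "\<lambda>_. 1" e] emeasure_space_1 by simp
  finally show "(\<integral>\<^sup>+z. ennreal (exp (z \<bullet> d)) \<partial>isotropic_gaussian \<tau>) < \<infinity>"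
    by simp
qed auto

lemma integrable_inner_isotropic_gaussian:
  fixes d :: "'p::euclidean_space"
  assumes "\<tau> > 0"
  shows "integrable (isotropic_gaussian \<tau>) (\<lambda>z. z \<bullet> d)"
proof (rule Bochner_Integration.integrable_bound)
  show "integrable (isotropic_gaussian \<tau>) (\<lambda>z. exp (z \<bullet> d) + exp (z \<bullet> (- d)))"
    by (intro Bochner_Integration.integrable_add integrable_exp_inner_isotropic_gaussian assms)
  have "\<bar>x\<bar> \<le> exp x + exp (- x)" for x :: real
    using exp_ge_add_one_self[of x] exp_ge_add_one_self[of "-x"] exp_gt_zero[of x] exp_gt_zero[of "-x"]
    by linarith
  then show "AE z in isotropic_gaussian \<tau>. norm (z \<bullet> d) \<le> norm (exp (z \<bullet> d) + exp (z \<bullet> (- d)))"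
    by (simp add: add_nonneg_nonneg)
qed simp

text \<open>By this symmetry linear functionals have mean 0 without any computation.\<close>

lemma distr_uminus_isotropic_gaussian:
  fixes \<tau> :: real
  assumes "\<tau> > 0"
  shows "distr (isotropic_gaussian \<tau>) borel uminus = (isotropic_gaussian \<tau> :: 'p::euclidean_space measure)"
proof -
  have *: "distr lborel borel uminus = (lborel :: 'p measure)"
    by (subst lborel_affine[of "-1" 0]) (auto simp: density_1 distr_distr comp_def)
  define g where "g z = ennreal ((1 / sqrt (2 * pi * \<tau>\<^sup>2)) ^ DIM('p) * exp (- (norm z)\<^sup>2 / (2 * \<tau>\<^sup>2)))"
    for z :: 'p
  have g: "g \<in> borel_measurable borel" "(\<lambda>z. g (- z)) = g"
    by (simp_all add: g_def[abs_def])
  have "density lborel g = density (distr lborel borel uminus) g"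
    by (simp only: *)
  also have "\<dots> = distr (density lborel g) borel uminus"
    using density_distr[of g borel "uminus :: 'p \<Rightarrow> 'p" lborel] g by simp
  finally show ?thesis
    unfolding isotropic_gaussian_altdef[OF assms] g_def[symmetric] by (rule sym)
qed

lemma integral_inner_isotropic_gaussian:
  fixes d :: "'p::euclidean_space"
  assumes "\<tau> > 0"
  shows "(LINT z|isotropic_gaussian \<tau>. z \<bullet> d) = 0"
proof -
  have "(LINT z|isotropic_gaussian \<tau>. z \<bullet> d) =
      (LINT z|distr (isotropic_gaussian \<tau>) borel uminus. z \<bullet> d)"
    by (simp add: distr_uminus_isotropic_gaussian[OF assms])
  also have "\<dots> = - (LINT z|isotropic_gaussian \<tau>. z \<bullet> d)"
    by (subst integral_distr) auto
  finally show ?thesis by simp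
qed

text \<open>The Donsker--Varadhan inequality for two Gaussians: the last term is their relative entropy.\<close>

lemma isotropic_gaussian_variational:
  fixes \<phi> :: "'p::euclidean_space \<Rightarrow> real"
  assumes \<tau>: "\<tau> > 0" and [measurable]: "\<phi> \<in> borel_measurable borel" and b: "\<And>z. \<bar>\<phi> z\<bar> \<le> b"
  shows "(LINT z|isotropic_gaussian \<tau>. \<phi> (m + z)) \<le>
    ln (LINT z|isotropic_gaussian \<tau>. exp (\<phi> (m' + z))) + (norm (m - m'))\<^sup>2 / (2 * \<tau>\<^sup>2)"
proof -
  interpret prob_space "isotropic_gaussian \<tau> :: 'p measure"
    by (rule prob_space_isotropic_gaussian[OF \<tau>])
  define d where "d = m - m'"
  \<comment> \<open>\<open>L z\<close> is the log-density, at the point \<open>m + z\<close>, of the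
    Gaussian centred at \<open>m'\<close> relative to the one centred at \<open>m\<close>. Its mean
    is minus the relative entropy, so Jensen's inequality for \<open>\<phi> (m + z) + L z\<close>
    gives the claim.\<close>
  define L where "L z = - (2 * (z \<bullet> d) + (norm d)\<^sup>2) / (2 * \<tau>\<^sup>2)" for z
  have [measurable]: "L \<in> borel_measurable borel"
    unfolding L_def by measurable
  have L: "integrable (isotropic_gaussian \<tau>) L"
      "(LINT z|isotropic_gaussian \<tau>. L z) = - (norm d)\<^sup>2 / (2 * \<tau>\<^sup>2)"
    unfolding L_def using integrable_inner_isotropic_gaussian[OF \<tau>, of d]
    by (auto simp: integral_inner_isotropic_gaussian[OF \<tau>] prob_space[simplified])
  have \<phi>: "integrable (isotropic_gaussian \<tau>) (\<lambda>z. \<phi> (m + z))"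
    using b by (intro integrable_const_bound[where B = b]) auto
  have exp\<phi>: "integrable (isotropic_gaussian \<tau>) (\<lambda>z. exp (\<phi> (m' + z)))"
    using b by (intro integrable_const_bound[where B = "exp b"]) (auto simp: abs_le_iff)
  define E where "E = (LINT z|isotropic_gaussian \<tau>. exp (\<phi> (m' + z)))"
  have nn: "ennreal E = (\<integral>\<^sup>+z. ennreal (exp (\<phi> (m + z) + L z)) \<partial>isotropic_gaussian \<tau>)"
    unfolding E_def using nn_integral_isotropic_gaussian_shift[OF \<tau>, of "\<lambda>z. ennreal (exp (\<phi> (m' + z)))" d]
    by (subst nn_integral_eq_integral[symmetric])
       (auto simp: exp\<phi> L_def d_def exp_add ennreal_mult)
  have expL: "integrable (isotropic_gaussian \<tau>) (\<lambda>z. exp (\<phi> (m + z) + L z))"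
    by (rule integrableI_nonneg) (auto simp flip: nn)
  have E: "(LINT z|isotropic_gaussian \<tau>. exp (\<phi> (m + z) + L z)) = E"
    using nn by (subst (asm) nn_integral_eq_integral) (auto simp: expL E_def)
  have "(LINT z|isotropic_gaussian \<tau>. \<phi> (m + z) + L z) \<le> ln E"
    using expectation_le_ln_expectation_exp[OF Bochner_Integration.integrable_add[OF \<phi> L(1)] expL]
    by (simp only: E)
  then show ?thesis
    using \<phi> L by (simp add: E_def d_def)
qed

subsection \<open>Integral functionals of processes with equal laws\<close>

text \<open>A non-integrable \<open>f\<close> has expectation 0 by convention, and \<open>b\<close>
  is nonnegative as it bounds an absolute value. Hence the bound can be applied without a
  measurability check.\<close>

lemma (in prob_space) abs_expectation_le:
  fixes f :: "'a \<Rightarrow> real"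
  assumes b: "\<And>x. \<bar>f x\<bar> \<le> b"
  shows "\<bar>expectation f\<bar> \<le> b"
proof (cases "integrable M f")
  case True
  have "expectation f \<le> b" "- b \<le> expectation f"
    using b by (auto intro!: integral_le_const integral_ge_const AE_I2 True simp: abs_le_iff minus_le_iff)
  then show ?thesis by simp
next
  case False
  then show ?thesis
    using order_trans[OF abs_ge_zero b] by (simp add: not_integrable_integral_eq)
qed

lemma (in prob_space) integral_mult_integral_swap:
  assumes \<mu>: "prob_space \<mu>"
    and [measurable]: "(\<lambda>(x, \<omega>). p x \<omega>) \<in> borel_measurable (\<mu> \<Otimes>\<^sub>M M)" "W \<in> borel_measurable M"
    and b: "\<And>x \<omega>. \<bar>p x \<omega>\<bar> \<le> (b::real)" and B: "\<And>\<omega>. \<bar>W \<omega>\<bar> \<le> (B::real)"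
  shows "(LINT \<omega>|M. W \<omega> * (LINT x|\<mu>. p x \<omega>)) = (LINT x|\<mu>. LINT \<omega>|M. W \<omega> * p x \<omega>)"
proof -
  interpret \<mu>: prob_space \<mu> by fact
  interpret pair_prob_space M \<mu> ..
  have "integrable (M \<Otimes>\<^sub>M \<mu>) (\<lambda>(\<omega>, x). W \<omega> * p x \<omega>)"
  proof (rule P.integrable_const_bound)
    show "AE z in M \<Otimes>\<^sub>M \<mu>. norm (case z of (\<omega>, x) \<Rightarrow> W \<omega> * p x \<omega>) \<le> B * b"
      by (auto simp: abs_mult split_beta intro!: AE_I2 mult_mono b B order_trans[OF abs_ge_zero B])
  qed measurable
  from Fubini_integral[OF this] show ?thesis by simp
qed

text \<open>Equality of laws on the product sigma-algebra is not directly applicable to integrals over \<open>x\<close>.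
  Fubini moves one factor \<open>\<psi> x (F x)\<close> at a time into \<open>Z\<close>, which is why \<open>Z\<close> is generalised.\<close>

lemma equal_law_mixed_moments:
  fixes F1 :: "'x \<Rightarrow> 'a \<Rightarrow> real" and F2 :: "'x \<Rightarrow> 'b \<Rightarrow> real" and \<psi> :: "'x \<Rightarrow> real \<Rightarrow> real"
  assumes \<mu>: "prob_space \<mu>" and N: "prob_space N1" "prob_space N2"
    and F[measurable]: "(\<lambda>(x, \<omega>). F1 x \<omega>) \<in> borel_measurable (\<mu> \<Otimes>\<^sub>M N1)"
      "(\<lambda>(x, \<omega>). F2 x \<omega>) \<in> borel_measurable (\<mu> \<Otimes>\<^sub>M N2)"
    and law: "distr N1 (\<Pi>\<^sub>M x\<in>space \<mu>. borel) (\<lambda>\<omega>. \<lambda>x\<in>space \<mu>. F1 x \<omega>) =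
      distr N2 (\<Pi>\<^sub>M x\<in>space \<mu>. borel) (\<lambda>\<omega>. \<lambda>x\<in>space \<mu>. F2 x \<omega>)"
    and \<psi>[measurable]: "(\<lambda>(x, y). \<psi> x y) \<in> borel_measurable (\<mu> \<Otimes>\<^sub>M borel)"
    and b: "\<And>x y. \<bar>\<psi> x y\<bar> \<le> b"
    and "Z \<in> borel_measurable (\<Pi>\<^sub>M x\<in>space \<mu>. borel)" and "\<And>F. \<bar>Z F\<bar> \<le> (B::real)"
  shows "(LINT \<omega>|N1. Z (\<lambda>x\<in>space \<mu>. F1 x \<omega>) * (LINT x|\<mu>. \<psi> x (F1 x \<omega>)) ^ k) =
    (LINT \<omega>|N2. Z (\<lambda>x\<in>space \<mu>. F2 x \<omega>) * (LINT x|\<mu>. \<psi> x (F2 x \<omega>)) ^ k)"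
  using assms(9,10)
proof (induction k arbitrary: Z B)
  case (0 Z B)
  note [measurable] = 0(1)
  have [measurable]: "(\<lambda>\<omega>. \<lambda>x\<in>space \<mu>. F1 x \<omega>) \<in> N1 \<rightarrow>\<^sub>M (\<Pi>\<^sub>M x\<in>space \<mu>. borel)"
    "(\<lambda>\<omega>. \<lambda>x\<in>space \<mu>. F2 x \<omega>) \<in> N2 \<rightarrow>\<^sub>M (\<Pi>\<^sub>M x\<in>space \<mu>. borel)"
    by (intro measurable_restrict; measurable)+
  have "(LINT F|distr N1 (\<Pi>\<^sub>M x\<in>space \<mu>. borel) (\<lambda>\<omega>. \<lambda>x\<in>space \<mu>. F1 x \<omega>). Z F) =
      (LINT F|distr N2 (\<Pi>\<^sub>M x\<in>space \<mu>. borel) (\<lambda>\<omega>. \<lambda>x\<in>space \<mu>. F2 x \<omega>). Z F)"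
    by (simp only: law)
  then show ?case
    by (simp add: integral_distr del: restrict_apply)
next
  case (Suc k Z B)
  note [measurable] = Suc(2)
  \<comment> \<open>The factor pulled out is written through the coordinate \<open>x\<close> of the
    restricted path. For fixed \<open>x\<close> it is therefore a bounded measurable function on the
    product space and can be merged into \<open>Z\<close>.\<close>
  have step: "(LINT \<omega>|N. Z (\<lambda>x\<in>space \<mu>. F x \<omega>) * (LINT x|\<mu>. \<psi> x (F x \<omega>)) ^ Suc k) =
      (LINT x|\<mu>. LINT \<omega>|N. (Z (\<lambda>x\<in>space \<mu>. F x \<omega>) * \<psi> x ((\<lambda>x\<in>space \<mu>. F x \<omega>) x)) *
        (LINT x|\<mu>. \<psi> x (F x \<omega>)) ^ k)"
    if N: "prob_space N" and F[measurable]: "(\<lambda>(x, \<omega>). F x \<omega>) \<in> borel_measurable (\<mu> \<Otimes>\<^sub>M N)"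
    for N :: "'c measure" and F
  proof -
    interpret \<mu>: prob_space \<mu> by fact
    interpret N: prob_space N by fact
    have [measurable]: "(\<lambda>\<omega>. \<lambda>x\<in>space \<mu>. F x \<omega>) \<in> N \<rightarrow>\<^sub>M (\<Pi>\<^sub>M x\<in>space \<mu>. borel)"
      by (intro measurable_restrict; measurable)
    have I: "\<bar>LINT x|\<mu>. \<psi> x (F x \<omega>)\<bar> \<le> b" for \<omega>
      by (rule \<mu>.abs_expectation_le) (rule b)
    have "(LINT \<omega>|N. Z (\<lambda>x\<in>space \<mu>. F x \<omega>) * (LINT x|\<mu>. \<psi> x (F x \<omega>)) ^ Suc k) =
        (LINT \<omega>|N. (Z (\<lambda>x\<in>space \<mu>. F x \<omega>) * (LINT x|\<mu>. \<psi> x (F x \<omega>)) ^ k) * (LINT x|\<mu>. \<psi> x (F x \<omega>)))"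
      by (simp add: mult_ac)
    also have "\<dots> = (LINT x|\<mu>. LINT \<omega>|N. (Z (\<lambda>x\<in>space \<mu>. F x \<omega>) * (LINT x|\<mu>. \<psi> x (F x \<omega>)) ^ k) * \<psi> x (F x \<omega>))"
    proof (rule N.integral_mult_integral_swap[OF \<mu>])
      show "\<bar>Z (\<lambda>x\<in>space \<mu>. F x \<omega>) * (LINT x|\<mu>. \<psi> x (F x \<omega>)) ^ k\<bar> \<le> B * b ^ k" for \<omega>
        unfolding abs_mult power_abs
        by (intro mult_mono power_mono I Suc(3) order_trans[OF abs_ge_zero Suc(3)]) auto
    qed (use b in measurable)
    also have "\<dots> = (LINT x|\<mu>. LINT \<omega>|N. (Z (\<lambda>x\<in>space \<mu>. F x \<omega>) * \<psi> x ((\<lambda>x\<in>space \<mu>. F x \<omega>) x)) *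
        (LINT x|\<mu>. \<psi> x (F x \<omega>)) ^ k)"
      by (intro Bochner_Integration.integral_cong) (auto simp: mult_ac)
    finally show ?thesis .
  qed
  show ?case
    unfolding step[OF N(1) F(1)] step[OF N(2) F(2)]
  proof (rule Bochner_Integration.integral_cong[OF refl])
    fix x assume [measurable]: "x \<in> space \<mu>"
    have "(\<lambda>y. \<psi> x y) \<in> borel_measurable borel"
      by measurable
    then have "(\<lambda>F. Z F * \<psi> x (F x)) \<in> borel_measurable (\<Pi>\<^sub>M x\<in>space \<mu>. borel)"
      by measurable
    moreover have "\<bar>Z F * \<psi> x (F x)\<bar> \<le> B * b" for F
      by (auto simp: abs_mult intro!: mult_mono b Suc(3) order_trans[OF abs_ge_zero Suc(3)])
    ultimately show "(LINT \<omega>|N1. (Z (\<lambda>x\<in>space \<mu>. F1 x \<omega>) * \<psi> x ((\<lambda>x\<in>space \<mu>. F1 x \<omega>) x)) *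
        (LINT x|\<mu>. \<psi> x (F1 x \<omega>)) ^ k) = (LINT \<omega>|N2. (Z (\<lambda>x\<in>space \<mu>. F2 x \<omega>) *
        \<psi> x ((\<lambda>x\<in>space \<mu>. F2 x \<omega>) x)) * (LINT x|\<mu>. \<psi> x (F2 x \<omega>)) ^ k)"
      by (rule Suc.IH)
  qed
qed

text \<open>Equal moments give equal integrals of polynomials, and by Weierstrass these approximate
  \<open>u\<close> uniformly on the compact interval containing both ranges.\<close>

lemma equal_moments_imp_equal_integral:
  fixes I1 :: "'a \<Rightarrow> real" and I2 :: "'b \<Rightarrow> real"
  assumes N: "prob_space N1" "prob_space N2"
    and I[measurable]: "I1 \<in> borel_measurable N1" "I2 \<in> borel_measurable N2"
    and bounds: "\<And>\<omega>. I1 \<omega> \<in> {0..b}" "\<And>\<omega>. I2 \<omega> \<in> {0..b}"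
    and moments: "\<And>k. (LINT \<omega>|N1. I1 \<omega> ^ k) = (LINT \<omega>|N2. I2 \<omega> ^ k)"
    and u: "continuous_on UNIV (u :: real \<Rightarrow> real)"
  shows "(LINT \<omega>|N1. u (I1 \<omega>)) = (LINT \<omega>|N2. u (I2 \<omega>))"
proof -
  interpret N1: prob_space N1 by fact
  interpret N2: prob_space N2 by fact
  have [measurable]: "u \<in> borel_measurable borel"
    using u by (rule borel_measurable_continuous_onI)
  have "bounded (u ` {0..b})"
    using u by (intro compact_imp_bounded compact_continuous_image continuous_on_subset[OF u]) auto
  then obtain c where c: "\<And>y. y \<in> {0..b} \<Longrightarrow> \<bar>u y\<bar> \<le> c"
    unfolding bounded_iff image_iff real_norm_def by blast
  have int_u: "integrable N1 (\<lambda>\<omega>. u (I1 \<omega>))" "integrable N2 (\<lambda>\<omega>. u (I2 \<omega>))"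
    using c bounds by (auto intro!: N1.integrable_const_bound[of _ c] N2.integrable_const_bound[of _ c])
  have int_pow: "integrable N1 (\<lambda>\<omega>. I1 \<omega> ^ k)" "integrable N2 (\<lambda>\<omega>. I2 \<omega> ^ k)" for k
    using bounds by (auto intro!: N1.integrable_const_bound[of _ "b ^ k"]
        N2.integrable_const_bound[of _ "b ^ k"] AE_I2 power_mono)
  have "\<bar>(LINT \<omega>|N1. u (I1 \<omega>)) - (LINT \<omega>|N2. u (I2 \<omega>))\<bar> \<le> e" if "e > 0" for e
  proof -
    have "compact {0..b}" "continuous_on {0..b} u" "0 < e / 2"
      using that continuous_on_subset[OF u] by auto
    then obtain g where g: "real_polynomial_function g" "\<And>y. y \<in> {0..b} \<Longrightarrow> \<bar>u y - g y\<bar> < e / 2"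
      by (rule Stone_Weierstrass_real_polynomial_function) blast
    then obtain a n where "g = (\<lambda>y. \<Sum>i\<le>n. a i * y ^ i)"
      using real_polynomial_function_iff_sum by blast
    then have geq: "(LINT \<omega>|N1. g (I1 \<omega>)) = (LINT \<omega>|N2. g (I2 \<omega>))"
      and int_g: "integrable N1 (\<lambda>\<omega>. g (I1 \<omega>))" "integrable N2 (\<lambda>\<omega>. g (I2 \<omega>))"
      using int_pow by (simp_all add: moments)
    have "\<bar>(LINT \<omega>|N1. u (I1 \<omega>)) - (LINT \<omega>|N1. g (I1 \<omega>))\<bar> \<le> e / 2"
      using N1.abs_expectation_le[of "\<lambda>\<omega>. u (I1 \<omega>) - g (I1 \<omega>)" "e / 2"] less_imp_le[OF g(2)] bounds
      by (simp add: int_u int_g)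
    moreover have "\<bar>(LINT \<omega>|N2. u (I2 \<omega>)) - (LINT \<omega>|N2. g (I2 \<omega>))\<bar> \<le> e / 2"
      using N2.abs_expectation_le[of "\<lambda>\<omega>. u (I2 \<omega>) - g (I2 \<omega>)" "e / 2"] less_imp_le[OF g(2)] bounds
      by (simp add: int_u int_g)
    ultimately show ?thesis
      using geq by linarith
  qed
  from field_le_epsilon[of _ 0, simplified, OF this] show ?thesis
    by simp
qed

lemma equal_moments_imp_equal_cdf:
  fixes I1 :: "'a \<Rightarrow> real" and I2 :: "'b \<Rightarrow> real"
  assumes N: "prob_space N1" "prob_space N2"
    and I[measurable]: "I1 \<in> borel_measurable N1" "I2 \<in> borel_measurable N2"
    and bounds: "\<And>\<omega>. I1 \<omega> \<in> {0..b}" "\<And>\<omega>. I2 \<omega> \<in> {0..b}"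
    and moments: "\<And>k. (LINT \<omega>|N1. I1 \<omega> ^ k) = (LINT \<omega>|N2. I2 \<omega> ^ k)"
  shows "measure N1 {\<omega>\<in>space N1. I1 \<omega> \<le> c} = measure N2 {\<omega>\<in>space N2. I2 \<omega> \<le> c}"
proof -
  \<comment> \<open>Continuous ramps: 1 up to \<open>c\<close>, then falling with slope
    \<open>-m\<close>. They approach the indicator from above, so the limit is right even when the
    law has an atom at \<open>c\<close>.\<close>
  define u :: "nat \<Rightarrow> real \<Rightarrow> real" where "u m y = max 0 (1 - real m * max 0 (y - c))" for m y
  have lim_u: "(\<lambda>m. u m y) \<longlonglongrightarrow> indicator {..c} y" for y
  proof (cases "y \<le> c")
    case True
    then show ?thesis by (simp add: u_def)
  next
    case False
    then obtain m0 :: nat where m0: "1 < real m0 * (y - c)"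
      using ex_less_of_nat_mult[of "y - c" 1] by auto
    have mono: "real m0 * (y - c) \<le> real m * (y - c)" if "m \<ge> m0" for m
      using that False by (intro mult_right_mono) auto
    have "u m y = 0" if "m \<ge> m0" for m
      using False less_le_trans[OF m0 mono[OF that]] by (simp add: u_def)
    then have "\<forall>\<^sub>F m in sequentially. u m y = 0"
      by (auto simp: eventually_sequentially)
    then show ?thesis
      using False by (auto intro: tendsto_eventually)
  qed
  have [measurable]: "u m \<in> borel_measurable borel" for m
    unfolding u_def by measurable
  have lim: "(\<lambda>m. LINT \<omega>|N. u m (I \<omega>)) \<longlonglongrightarrow> measure N {\<omega>\<in>space N. I \<omega> \<le> c}"
    if "prob_space N" and [measurable]: "I \<in> borel_measurable N" for N :: "'c measure" and I
  proof -
    interpret prob_space N by fact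
    have "(\<lambda>m. LINT \<omega>|N. u m (I \<omega>)) \<longlonglongrightarrow> (LINT \<omega>|N. indicator {..c} (I \<omega>))"
      by (rule integral_dominated_convergence[where w = "\<lambda>_. 1"]) (auto simp: lim_u, auto simp: u_def)
    also have "(LINT \<omega>|N. indicator {..c} (I \<omega>)) = (LINT \<omega>|N. indicator {\<omega>\<in>space N. I \<omega> \<le> c} \<omega>)"
      by (intro Bochner_Integration.integral_cong) (auto simp: indicator_def)
    also have "\<dots> = measure N {\<omega>\<in>space N. I \<omega> \<le> c}"
      by (simp add: Int_def conj_commute cong: conj_cong)
    finally show ?thesis .
  qed
  have "(LINT \<omega>|N1. u m (I1 \<omega>)) = (LINT \<omega>|N2. u m (I2 \<omega>))" for m
    by (rule equal_moments_imp_equal_integral[OF N I bounds moments])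
       (auto simp: u_def intro!: continuous_intros)
  then show ?thesis
    using LIMSEQ_unique[OF lim[OF N(1) I(1)]] lim[OF N(2) I(2)] by simp
qed

text \<open>Truncating \<open>\<Phi>\<close> at \<open>n\<close> makes the integral bounded, so its
  law is determined by its moments; monotone convergence in \<open>n\<close> removes the truncation.
  The nonnegative integral is infinite where \<open>\<Phi>\<close> is not integrable, which keeps
  such outcomes out of the event.\<close>

lemma equal_law_imp_equal_integral_law:
  fixes F1 :: "'x \<Rightarrow> 'a \<Rightarrow> real" and F2 :: "'x \<Rightarrow> 'b \<Rightarrow> real" and \<Phi> :: "'x \<Rightarrow> real \<Rightarrow> real"
  assumes \<mu>: "prob_space \<mu>" and N: "prob_space N1" "prob_space N2"
    and F[measurable]: "(\<lambda>(x, \<omega>). F1 x \<omega>) \<in> borel_measurable (\<mu> \<Otimes>\<^sub>M N1)"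
      "(\<lambda>(x, \<omega>). F2 x \<omega>) \<in> borel_measurable (\<mu> \<Otimes>\<^sub>M N2)"
    and law: "distr N1 (\<Pi>\<^sub>M x\<in>space \<mu>. borel) (\<lambda>\<omega>. \<lambda>x\<in>space \<mu>. F1 x \<omega>) =
      distr N2 (\<Pi>\<^sub>M x\<in>space \<mu>. borel) (\<lambda>\<omega>. \<lambda>x\<in>space \<mu>. F2 x \<omega>)"
    and \<Phi>[measurable]: "(\<lambda>(x, y). \<Phi> x y) \<in> borel_measurable (\<mu> \<Otimes>\<^sub>M borel)"
    and \<Phi>_nonneg: "\<And>x y. 0 \<le> \<Phi> x y" and c: "0 \<le> c"
  shows "measure N1 {\<omega>\<in>space N1. (\<integral>\<^sup>+x. ennreal (\<Phi> x (F1 x \<omega>)) \<partial>\<mu>) \<le> ennreal c} =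
    measure N2 {\<omega>\<in>space N2. (\<integral>\<^sup>+x. ennreal (\<Phi> x (F2 x \<omega>)) \<partial>\<mu>) \<le> ennreal c}"
proof -
  interpret \<mu>: prob_space \<mu> by fact
  define \<psi> where "\<psi> n x y = min (\<Phi> x y) (real n)" for n x y
  have \<psi>[measurable]: "(\<lambda>(x, y). \<psi> n x y) \<in> borel_measurable (\<mu> \<Otimes>\<^sub>M borel)" for n
    unfolding \<psi>_def by measurable
  have \<psi>_bounds: "0 \<le> \<psi> n x y" "\<psi> n x y \<le> real n" for n x y
    by (auto simp: \<psi>_def \<Phi>_nonneg)
  have I_bounds: "(LINT x|\<mu>. \<psi> n x (f x)) \<in> {0..real n}" for n f
  proof (cases "integrable \<mu> (\<lambda>x. \<psi> n x (f x))")
    case True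
    then show ?thesis
      using integral_mono[OF True, of "\<lambda>_. real n"] \<psi>_bounds by (auto simp: \<mu>.prob_space)
  qed (auto simp: not_integrable_integral_eq)
  have lim: "(\<lambda>n. measure N {\<omega>\<in>space N. (LINT x|\<mu>. \<psi> n x (F x \<omega>)) \<le> c}) \<longlonglongrightarrow>
      measure N {\<omega>\<in>space N. (\<integral>\<^sup>+x. ennreal (\<Phi> x (F x \<omega>)) \<partial>\<mu>) \<le> ennreal c}"
    if N: "prob_space N" and F[measurable]: "(\<lambda>(x, \<omega>). F x \<omega>) \<in> borel_measurable (\<mu> \<Otimes>\<^sub>M N)"
    for N :: "'c measure" and F
  proof -
    interpret N: prob_space N by fact
    \<comment> \<open>Larger truncation levels give larger integrals, so these events decrease;
      their intersection is the event for \<open>\<Phi>\<close> itself.\<close>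
    define A where "A n = {\<omega>\<in>space N. (LINT x|\<mu>. \<psi> n x (F x \<omega>)) \<le> c}" for n
    have int: "integrable \<mu> (\<lambda>x. \<psi> n x (F x \<omega>))" if [measurable]: "\<omega> \<in> space N" for n \<omega>
      using \<psi>_bounds by (intro \<mu>.integrable_const_bound[of _ "real n"]) auto
    have "(\<lambda>n. measure N (A n)) \<longlonglongrightarrow> measure N (\<Inter>n. A n)"
    proof (rule N.finite_Lim_measure_decseq)
      show "range A \<subseteq> sets N"
        unfolding A_def by auto
      show "decseq A"
      proof (rule decseq_SucI, rule subsetI)
        fix n \<omega> assume "\<omega> \<in> A (Suc n)"
        moreover from this have "(LINT x|\<mu>. \<psi> n x (F x \<omega>)) \<le> (LINT x|\<mu>. \<psi> (Suc n) x (F x \<omega>))"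
          by (intro integral_mono int) (auto simp: A_def \<psi>_def)
        ultimately show "\<omega> \<in> A n"
          by (auto simp: A_def)
      qed
    qed
    also have "(\<Inter>n. A n) = {\<omega>\<in>space N. (\<integral>\<^sup>+x. ennreal (\<Phi> x (F x \<omega>)) \<partial>\<mu>) \<le> ennreal c}"
    proof -
      have "(\<forall>n. (LINT x|\<mu>. \<psi> n x (F x \<omega>)) \<le> c) \<longleftrightarrow> (\<integral>\<^sup>+x. ennreal (\<Phi> x (F x \<omega>)) \<partial>\<mu>) \<le> ennreal c"
        if [measurable]: "\<omega> \<in> space N" for \<omega>
      proof -
        have "(SUP n. ennreal (\<psi> n x (F x \<omega>))) = ennreal (\<Phi> x (F x \<omega>))" for x
        proof (rule antisym)
          obtain n :: nat where "\<Phi> x (F x \<omega>) \<le> real n"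
            using real_arch_simple by blast
          then show "ennreal (\<Phi> x (F x \<omega>)) \<le> (SUP n. ennreal (\<psi> n x (F x \<omega>)))"
            by (intro SUP_upper2[of n]) (auto simp: \<psi>_def)
        qed (auto intro!: SUP_least ennreal_leI simp: \<psi>_def)
        then have "(\<integral>\<^sup>+x. ennreal (\<Phi> x (F x \<omega>)) \<partial>\<mu>) = (\<integral>\<^sup>+x. (SUP n. ennreal (\<psi> n x (F x \<omega>))) \<partial>\<mu>)"
          by simp
        also have "\<dots> = (SUP n. \<integral>\<^sup>+x. ennreal (\<psi> n x (F x \<omega>)) \<partial>\<mu>)"
          by (intro nn_integral_monotone_convergence_SUP)
             (auto simp: incseq_def le_fun_def \<psi>_def intro!: ennreal_leI)
        also have "\<dots> = (SUP n. ennreal (LINT x|\<mu>. \<psi> n x (F x \<omega>)))"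
          using int[OF that] \<psi>_bounds by (subst nn_integral_eq_integral) auto
        finally show ?thesis
          using c by (simp add: SUP_le_iff ennreal_le_iff)
      qed
      then show ?thesis
        by (auto simp: A_def)
    qed
    finally show ?thesis
      by (simp add: A_def)
  qed
  have "measure N1 {\<omega>\<in>space N1. (LINT x|\<mu>. \<psi> n x (F1 x \<omega>)) \<le> c} =
      measure N2 {\<omega>\<in>space N2. (LINT x|\<mu>. \<psi> n x (F2 x \<omega>)) \<le> c}" for n
  proof (rule equal_moments_imp_equal_cdf[OF N _ _ I_bounds I_bounds])
    show "(LINT \<omega>|N1. (LINT x|\<mu>. \<psi> n x (F1 x \<omega>)) ^ k) = (LINT \<omega>|N2. (LINT x|\<mu>. \<psi> n x (F2 x \<omega>)) ^ k)" for k
      using equal_law_mixed_moments[OF \<mu> N F law \<psi>, of n "real n" "\<lambda>_. 1" 1 k] \<psi>_bounds by simp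
  qed measurable
  then show ?thesis
    using LIMSEQ_unique[OF lim[OF N(1) F(1)]] lim[OF N(2) F(2)] by simp
qed

subsection \<open>Comparison of noisy gradient descent trajectories\<close>

lemma borel_measurable_gd_iterate:
  fixes f :: "'x \<Rightarrow> 'p::euclidean_space \<Rightarrow> real"
  assumes [measurable]: "population_gradient f f' R D \<in> borel_measurable borel"
    and [measurable_cong]: "sets \<mu>0 = sets borel"
  shows "(\<lambda>\<omega>. gd_iterate f f' R \<eta> D \<omega> k) \<in> borel_measurable (gd_randomness \<mu>0 \<tau>)"
proof (induction k)
  case (Suc k)
  note [measurable] = Suc
  have [measurable]: "(\<lambda>\<omega>. snd \<omega> k) \<in> borel_measurable (gd_randomness \<mu>0 \<tau>)"
    unfolding gd_randomness_def by measurable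
  show ?case by simp
qed (simp add: gd_randomness_def)

lemma gd_iterate_cong:
  assumes "fst \<omega> = fst \<omega>'" "\<And>i. i < k \<Longrightarrow> snd \<omega> i = snd \<omega>' i"
  shows "gd_iterate f f' R \<eta> D \<omega> k = gd_iterate f f' R \<eta> D \<omega>' k"
  using assms by (induction k) auto

lemma prob_space_gd_randomness:
  fixes \<mu>0 :: "'p::euclidean_space measure"
  assumes "prob_space \<mu>0" "\<tau> > 0"
  shows "prob_space (gd_randomness \<mu>0 \<tau>)"
proof -
  interpret \<mu>0: prob_space \<mu>0 by fact
  interpret \<gamma>: prob_space "isotropic_gaussian \<tau> :: 'p measure"
    by (rule prob_space_isotropic_gaussian[OF assms(2)])
  interpret seq: sequence_space "isotropic_gaussian \<tau> :: 'p measure" ..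
  interpret \<mu>0S: pair_prob_space \<mu>0 "\<Pi>\<^sub>M k\<in>(UNIV :: nat set). (isotropic_gaussian \<tau> :: 'p measure)" ..
  show ?thesis
    unfolding gd_randomness_def by unfold_locales
qed

text \<open>The noise \<open>\<xi>\<^sub>k\<close> is independent of \<open>\<theta>\<^sub>k\<close>: resampling the noise from time \<open>k\<close> on does not change
  its law.\<close>

lemma integral_gd_iterate_Suc:
  fixes f :: "'x \<Rightarrow> 'p::euclidean_space \<Rightarrow> real" and \<psi> :: "'p \<Rightarrow> real"
  assumes \<mu>0: "prob_space \<mu>0" "sets \<mu>0 = sets borel" and \<tau>: "\<tau> > 0"
    and pg[measurable]: "population_gradient f f' R D \<in> borel_measurable borel"
    and [measurable]: "\<psi> \<in> borel_measurable borel" and b: "\<And>\<theta>. \<bar>\<psi> \<theta>\<bar> \<le> b"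
  shows "(LINT \<omega>|gd_randomness \<mu>0 \<tau>. \<psi> (gd_iterate f f' R \<eta> D \<omega> (Suc k))) =
    (LINT \<omega>|gd_randomness \<mu>0 \<tau>. LINT z|isotropic_gaussian \<tau>.
      \<psi> (gd_iterate f f' R \<eta> D \<omega> k
        - \<eta> k *\<^sub>R (population_gradient f f' R D (gd_iterate f f' R \<eta> D \<omega> k) + z)))"
proof -
  note [measurable_cong] = \<mu>0(2)
  let ?\<gamma> = "isotropic_gaussian \<tau> :: 'p measure"
  let ?S = "\<Pi>\<^sub>M k\<in>(UNIV :: nat set). ?\<gamma>"
  let ?gd = "gd_iterate f f' R \<eta> D"
  let ?step = "\<lambda>\<theta> z. \<psi> (\<theta> - \<eta> k *\<^sub>R (population_gradient f f' R D \<theta> + z))"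
  interpret \<mu>0: prob_space \<mu>0 by fact
  interpret \<gamma>: prob_space ?\<gamma>
    by (rule prob_space_isotropic_gaussian[OF \<tau>])
  interpret seq: sequence_space ?\<gamma> ..
  interpret R: prob_space "gd_randomness \<mu>0 \<tau>"
    by (rule prob_space_gd_randomness[OF \<mu>0(1) \<tau>])
  interpret SS: pair_prob_space ?S ?S ..
  interpret \<mu>0S: pair_prob_space \<mu>0 ?S ..
  have gd_meas[measurable]: "(\<lambda>\<omega>. ?gd \<omega> j) \<in> borel_measurable (\<mu>0 \<Otimes>\<^sub>M ?S)" for j
    using borel_measurable_gd_iterate[OF pg \<mu>0(2)] unfolding gd_randomness_def .
  \<comment> \<open>The iterate at time \<open>k\<close> reads only noise of index below
    \<open>k\<close>, which comes from \<open>w\<close>; the noise of index \<open>k\<close> is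
    entry 0 of the fresh sequence \<open>w'\<close>.\<close>
  have gd_comb: "?gd (\<theta>, comb_seq k w w') k = ?gd (\<theta>, w) k" for \<theta> w w'
    by (rule gd_iterate_cong) (auto simp: comb_seq_less)
  have comb: "comb_seq k w w' k = w' 0" for w w' :: "nat \<Rightarrow> 'p"
    using comb_seq_add[of k w w' 0] by simp
  have [simp]: "space \<mu>0 = UNIV"
    using \<mu>0(2)[THEN sets_eq_imp_space_eq] by simp
  have bounded_integrable: "integrable M h" if "prob_space M" "h \<in> borel_measurable M" "\<And>x. \<bar>h x\<bar> \<le> b"
    for M :: "'z measure" and h :: "'z \<Rightarrow> real"
  proof -
    interpret M: prob_space M by fact
    show ?thesis
      using that by (intro M.integrable_const_bound[of _ b]) auto
  qed
  have "(LINT w|?S. \<psi> (?gd (\<theta>, w) (Suc k))) = (LINT w|?S. LINT z|?\<gamma>. ?step (?gd (\<theta>, w) k) z)" for \<theta>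
  proof -
    have [measurable]: "(\<lambda>w. ?gd (\<theta>, w) j) \<in> borel_measurable ?S" for j
      using measurable_compose[OF measurable_Pair1' gd_meas, of \<theta>] by simp
    have "(LINT w|?S. \<psi> (?gd (\<theta>, w) (Suc k))) =
        (LINT w|distr (?S \<Otimes>\<^sub>M ?S) ?S (\<lambda>(w, w'). comb_seq k w w'). \<psi> (?gd (\<theta>, w) (Suc k)))"
      by (simp only: seq.PiM_comb_seq)
    also have "\<dots> = (LINT p|(?S \<Otimes>\<^sub>M ?S). ?step (?gd (\<theta>, fst p) k) (snd p 0))"
      by (subst integral_distr[OF measurable_comb_seq])
         (measurable, auto simp: split_beta gd_comb comb intro!: Bochner_Integration.integral_cong)
    also have "\<dots> = (LINT w|?S. LINT w'|?S. ?step (?gd (\<theta>, w) k) (w' 0))"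
      by (subst SS.integral_fst'[symmetric]) (auto intro!: bounded_integrable SS.prob_space_axioms b)
    also have "\<dots> = (LINT w|?S. LINT z|distr ?S ?\<gamma> (\<lambda>w'. w' 0). ?step (?gd (\<theta>, w) k) z)"
      by (subst integral_distr) auto
    also have "\<dots> = (LINT w|?S. LINT z|?\<gamma>. ?step (?gd (\<theta>, w) k) z)"
      by (subst seq.PiM_component) auto
    finally show ?thesis .
  qed
  then have "(LINT \<theta>|\<mu>0. LINT w|?S. \<psi> (?gd (\<theta>, w) (Suc k))) =
      (LINT \<theta>|\<mu>0. LINT w|?S. LINT z|?\<gamma>. ?step (?gd (\<theta>, w) k) z)"
    by simp
  then show ?thesis
    unfolding gd_randomness_def
    by (subst (1 2) \<mu>0S.integral_fst'[symmetric])
       (auto intro!: bounded_integrable \<mu>0S.prob_space_axioms b \<gamma>.abs_expectation_le simp del: gd_iterate.simps)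
qed

text \<open>The chain rule for relative entropy in dual form: with test functions instead of
  densities, no relative entropy of path laws has to be defined. The last step is peeled off and the
  induction hypothesis is applied to a new test function, which is why \<open>\<phi>\<close> is
  generalised. All errors are evaluated along the trajectory of \<open>D\<close>.\<close>

lemma gd_iterate_variational:
  fixes f :: "'x \<Rightarrow> 'p::euclidean_space \<Rightarrow> real" and \<phi> \<delta> :: "'p \<Rightarrow> real"
  assumes \<mu>0: "prob_space \<mu>0" "sets \<mu>0 = sets borel" and \<tau>: "\<tau> > 0"
    and pg[measurable]: "population_gradient f f' R D \<in> borel_measurable borel"
      "population_gradient f f' R D' \<in> borel_measurable borel"
    and \<delta>[measurable]: "\<delta> \<in> borel_measurable borel"
    and close: "\<And>\<theta>. (norm (population_gradient f f' R D \<theta> - population_gradient f f' R D' \<theta>))\<^sup>2 \<le> \<delta> \<theta>"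
    and \<delta>_bound: "\<And>\<theta>. \<delta> \<theta> \<le> c"
    and \<phi>: "\<phi> \<in> borel_measurable borel" "\<And>\<theta>. \<bar>\<phi> \<theta>\<bar> \<le> b"
  shows "(LINT \<omega>|gd_randomness \<mu>0 \<tau>. \<phi> (gd_iterate f f' R \<eta> D \<omega> T)) \<le>
    ln (LINT \<omega>|gd_randomness \<mu>0 \<tau>. exp (\<phi> (gd_iterate f f' R \<eta> D' \<omega> T))) +
    (\<Sum>k<T. LINT \<omega>|gd_randomness \<mu>0 \<tau>. \<delta> (gd_iterate f f' R \<eta> D \<omega> k)) / (2 * \<tau>\<^sup>2)"
  using \<phi>
proof (induction T arbitrary: \<phi>)
  let ?\<gamma> = "isotropic_gaussian \<tau> :: 'p measure" and ?R = "gd_randomness \<mu>0 \<tau>"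
  let ?G = "population_gradient f f' R D" and ?G' = "population_gradient f f' R D'"
  let ?gd = "gd_iterate f f' R \<eta> D" and ?gd' = "gd_iterate f f' R \<eta> D'"
  interpret \<gamma>: prob_space ?\<gamma>
    by (rule prob_space_isotropic_gaussian[OF \<tau>])
  interpret R: prob_space ?R
    by (rule prob_space_gd_randomness[OF \<mu>0(1) \<tau>])
  have [measurable]: "(\<lambda>\<omega>. ?gd \<omega> k) \<in> borel_measurable ?R" "(\<lambda>\<omega>. ?gd' \<omega> k) \<in> borel_measurable ?R" for k
    using borel_measurable_gd_iterate \<mu>0(2) pg by blast+
  have exp_bounds: "exp (- b) \<le> exp y" "exp y \<le> exp b" if "\<bar>y\<bar> \<le> b" for y
    using that by (auto simp: abs_le_iff)
  {
    case (0 \<phi>)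
    note [measurable] = 0(1)
    have "(\<lambda>\<omega>. \<phi> (?gd \<omega> 0)) \<in> borel_measurable ?R" by measurable
    then have "integrable ?R (\<lambda>\<omega>. \<phi> (fst \<omega>))" "integrable ?R (\<lambda>\<omega>. exp (\<phi> (fst \<omega>)))"
      using 0(2) abs_le_D1[OF 0(2)]
      by (auto intro!: R.integrable_const_bound[of "\<lambda>\<omega>. \<phi> (fst \<omega>)" b]
          R.integrable_const_bound[of "\<lambda>\<omega>. exp (\<phi> (fst \<omega>))" "exp b"])
    then show ?case
      using R.expectation_le_ln_expectation_exp[of "\<lambda>\<omega>. \<phi> (fst \<omega>)"] by simp
  next
    case (Suc T \<phi>)
    note [measurable] = Suc(2)
    \<comment> \<open>The new test function is the logarithm of the exponential moment of
      \<open>\<phi>\<close> after one \<open>D'\<close>-step from \<open>\<theta>\<close>. It obeys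
      the same bound \<open>b\<close>, and its exponential, integrated along the
      \<open>D'\<close>-trajectory, restores the missing step.\<close>
    define W where "W \<theta> = ln (LINT z|?\<gamma>. exp (\<phi> (\<theta> - \<eta> T *\<^sub>R (?G' \<theta> + z))))" for \<theta>
    have W_bounds: "exp (- b) \<le> (LINT z|?\<gamma>. exp (\<phi> (\<theta> - \<eta> T *\<^sub>R (?G' \<theta> + z))))"
      "(LINT z|?\<gamma>. exp (\<phi> (\<theta> - \<eta> T *\<^sub>R (?G' \<theta> + z)))) \<le> exp b" for \<theta>
    proof -
      have "integrable ?\<gamma> (\<lambda>z. exp (\<phi> (\<theta> - \<eta> T *\<^sub>R (?G' \<theta> + z))))"
        using abs_le_D1[OF Suc(3)] by (intro \<gamma>.integrable_const_bound[of _ "exp b"]) auto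
      then show "exp (- b) \<le> (LINT z|?\<gamma>. exp (\<phi> (\<theta> - \<eta> T *\<^sub>R (?G' \<theta> + z))))"
        "(LINT z|?\<gamma>. exp (\<phi> (\<theta> - \<eta> T *\<^sub>R (?G' \<theta> + z)))) \<le> exp b"
        using exp_bounds Suc(3) by (auto intro!: \<gamma>.integral_ge_const \<gamma>.integral_le_const AE_I2)
    qed
    have W_pos: "0 < (LINT z|?\<gamma>. exp (\<phi> (\<theta> - \<eta> T *\<^sub>R (?G' \<theta> + z))))" for \<theta>
      by (rule less_le_trans[OF exp_gt_zero W_bounds(1)])
    have W_abs: "\<bar>W \<theta>\<bar> \<le> b" for \<theta>
      using W_bounds[of \<theta>] ln_ge_iff[OF W_pos[of \<theta>], of "- b"] ln_le_cancel_iff[OF W_pos[of \<theta>], of "exp b"]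
      by (simp add: W_def abs_le_iff)
    have W_meas[measurable]: "W \<in> borel_measurable borel"
      unfolding W_def by measurable
    have int_W: "integrable ?R (\<lambda>\<omega>. W (?gd \<omega> T))"
      using W_abs by (intro R.integrable_const_bound[of _ b]) auto
    have int_\<delta>: "integrable ?R (\<lambda>\<omega>. \<delta> (?gd \<omega> T))"
      using \<delta>_bound order_trans[OF zero_le_power2 close] by (intro R.integrable_const_bound[of _ c]) auto
    have "(LINT \<omega>|?R. \<phi> (?gd \<omega> (Suc T))) = (LINT \<omega>|?R. LINT z|?\<gamma>. \<phi> (?gd \<omega> T - \<eta> T *\<^sub>R (?G (?gd \<omega> T) + z)))"
      by (rule integral_gd_iterate_Suc[OF \<mu>0 \<tau> pg(1) Suc(2,3)])
    also have "\<dots> \<le> (LINT \<omega>|?R. W (?gd \<omega> T) + \<delta> (?gd \<omega> T) / (2 * \<tau>\<^sup>2))"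
    proof (rule integral_mono)
      \<comment> \<open>The step size is absorbed into the test function, so only the Gaussian means
        \<open>?G\<close> and \<open>?G'\<close> are compared.\<close>
      show "(LINT z|?\<gamma>. \<phi> (?gd \<omega> T - \<eta> T *\<^sub>R (?G (?gd \<omega> T) + z))) \<le> W (?gd \<omega> T) + \<delta> (?gd \<omega> T) / (2 * \<tau>\<^sup>2)" for \<omega>
        using isotropic_gaussian_variational[OF \<tau>, of "\<lambda>z. \<phi> (?gd \<omega> T - \<eta> T *\<^sub>R z)" b "?G (?gd \<omega> T)" "?G' (?gd \<omega> T)"]
          divide_right_mono[OF close[of "?gd \<omega> T"], of "2 * \<tau>\<^sup>2"] Suc(3)
        by (simp add: W_def)
      show "integrable ?R (\<lambda>\<omega>. LINT z|?\<gamma>. \<phi> (?gd \<omega> T - \<eta> T *\<^sub>R (?G (?gd \<omega> T) + z)))"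
        by (rule R.integrable_const_bound[of _ b]) (auto intro!: AE_I2 \<gamma>.abs_expectation_le Suc(3))
    qed (use int_\<delta> int_W in auto)
    also have "\<dots> = (LINT \<omega>|?R. W (?gd \<omega> T)) + (LINT \<omega>|?R. \<delta> (?gd \<omega> T)) / (2 * \<tau>\<^sup>2)"
      using int_\<delta> int_W by simp
    also have "(LINT \<omega>|?R. W (?gd \<omega> T)) \<le> ln (LINT \<omega>|?R. exp (W (?gd' \<omega> T))) +
        (\<Sum>k<T. LINT \<omega>|?R. \<delta> (?gd \<omega> k)) / (2 * \<tau>\<^sup>2)"
      by (rule Suc.IH[OF W_meas W_abs])
    also have "(LINT \<omega>|?R. exp (W (?gd' \<omega> T))) =
        (LINT \<omega>|?R. LINT z|?\<gamma>. exp (\<phi> (?gd' \<omega> T - \<eta> T *\<^sub>R (?G' (?gd' \<omega> T) + z))))"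
      unfolding W_def by (simp only: exp_ln[OF W_pos])
    also have "\<dots> = (LINT \<omega>|?R. exp (\<phi> (?gd' \<omega> (Suc T))))"
      by (rule integral_gd_iterate_Suc[OF \<mu>0 \<tau> pg(2), where b = "exp b", symmetric])
         (use exp_bounds Suc(3) in auto)
    finally show ?case
      by (simp add: add_divide_distrib add_ac)
  }
qed

text \<open>The Donsker--Varadhan inequality for the test function \<open>- l\<close> times the indicator of \<open>B\<close>, combined with
  Hoeffding's lemma. The parameter \<open>l\<close> is kept free (optimising it gives the usual square root), so
  that the bound stays linear in \<open>\<delta>\<close> and can be averaged over \<open>g\<close>.\<close>

lemma gd_iterate_pinsker:
  fixes f :: "'x \<Rightarrow> 'p::euclidean_space \<Rightarrow> real" and \<delta> :: "'p \<Rightarrow> real"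
  assumes \<mu>0: "prob_space \<mu>0" "sets \<mu>0 = sets borel" and \<tau>: "\<tau> > 0"
    and pg: "population_gradient f f' R D \<in> borel_measurable borel"
      "population_gradient f f' R D' \<in> borel_measurable borel"
    and \<delta>: "\<delta> \<in> borel_measurable borel"
    and close: "\<And>\<theta>. (norm (population_gradient f f' R D \<theta> - population_gradient f f' R D' \<theta>))\<^sup>2 \<le> \<delta> \<theta>"
    and \<delta>_bound: "\<And>\<theta>. \<delta> \<theta> \<le> c"
    and B[measurable]: "B \<in> sets borel" and l: "l > 0"
  shows "measure (gd_randomness \<mu>0 \<tau>) {\<omega> \<in> space (gd_randomness \<mu>0 \<tau>). gd_iterate f f' R \<eta> D' \<omega> T \<in> B} \<le>
    measure (gd_randomness \<mu>0 \<tau>) {\<omega> \<in> space (gd_randomness \<mu>0 \<tau>). gd_iterate f f' R \<eta> D \<omega> T \<in> B} +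
    (\<Sum>k<T. LINT \<omega>|gd_randomness \<mu>0 \<tau>. \<delta> (gd_iterate f f' R \<eta> D \<omega> k)) / (2 * \<tau>\<^sup>2 * l) + l / 8"
    (is "?p \<le> ?q + ?S / _ + _")
proof -
  let ?R = "gd_randomness \<mu>0 \<tau>"
  interpret R: prob_space ?R
    by (rule prob_space_gd_randomness[OF \<mu>0(1) \<tau>])
  have [measurable]: "(\<lambda>\<omega>. gd_iterate f f' R \<eta> D \<omega> T) \<in> borel_measurable ?R"
    "(\<lambda>\<omega>. gd_iterate f f' R \<eta> D' \<omega> T) \<in> borel_measurable ?R"
    using borel_measurable_gd_iterate \<mu>0(2) pg by blast+
  have ind: "(LINT \<omega>|?R. indicator B (F \<omega>)) = measure ?R {\<omega> \<in> space ?R. F \<omega> \<in> B}"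
      "integrable ?R (\<lambda>\<omega>. indicator B (F \<omega>) :: real)"
    if [measurable]: "F \<in> borel_measurable ?R" for F :: "_ \<Rightarrow> 'p"
  proof -
    have "(LINT \<omega>|?R. indicator B (F \<omega>)) = (LINT \<omega>|?R. indicator {\<omega> \<in> space ?R. F \<omega> \<in> B} \<omega> :: real)"
      by (intro Bochner_Integration.integral_cong) (auto simp: indicator_def)
    then show "(LINT \<omega>|?R. indicator B (F \<omega>)) = measure ?R {\<omega> \<in> space ?R. F \<omega> \<in> B}"
      by (simp add: Int_def conj_commute cong: conj_cong)
    show "integrable ?R (\<lambda>\<omega>. indicator B (F \<omega>) :: real)"
      by (rule R.integrable_const_bound[of _ 1]) (auto simp: indicator_def)
  qed
  have exp_ind: "exp (- l * indicator B \<theta>) = 1 - (1 - exp (- l)) * indicator B \<theta>" for \<theta>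
    by (simp add: indicator_def)
  have p: "0 \<le> ?p" "?p \<le> 1"
    by auto
  have pos: "1 + (1 - ?p) * (exp l - 1) > 0"
    using p l by (intro add_pos_nonneg mult_nonneg_nonneg) auto
  \<comment> \<open>The exponential moment at \<open>-l\<close> of a 0-1 variable with mean
    \<open>?p\<close> is rewritten through its complement at \<open>+l\<close>, the form in which
    Hoeffding's lemma is available.\<close>
  have "1 - (1 - exp (- l)) * ?p = exp (- l) * (1 + (1 - ?p) * (exp l - 1))"
    using exp_minus_inverse[of l] by (simp add: algebra_simps)
  then have "ln (1 - (1 - exp (- l)) * ?p) = - l + ln (1 + (1 - ?p) * (exp l - 1))"
    using pos by (simp add: ln_mult_pos)
  also have "\<dots> \<le> - l * ?p + l\<^sup>2 / 8"
    using Hoeffdings_lemma_aux[of l "1 - ?p"] l p by (simp add: algebra_simps)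
  finally have "ln (1 - (1 - exp (- l)) * ?p) \<le> - l * ?p + l\<^sup>2 / 8" .
  moreover have "- l * ?q \<le> ln (1 - (1 - exp (- l)) * ?p) + ?S / (2 * \<tau>\<^sup>2)"
  proof -
    have "(LINT \<omega>|?R. - l * indicator B (gd_iterate f f' R \<eta> D \<omega> T)) \<le>
        ln (LINT \<omega>|?R. exp (- l * indicator B (gd_iterate f f' R \<eta> D' \<omega> T))) + ?S / (2 * \<tau>\<^sup>2)"
      using l by (intro gd_iterate_variational[OF \<mu>0 \<tau> pg \<delta> close \<delta>_bound, where b = l])
        (auto simp: indicator_def)
    moreover have "(LINT \<omega>|?R. - l * indicator B (gd_iterate f f' R \<eta> D \<omega> T)) = - l * ?q"
      by (simp add: ind)
    moreover have "(LINT \<omega>|?R. exp (- l * indicator B (gd_iterate f f' R \<eta> D' \<omega> T))) = 1 - (1 - exp (- l)) * ?p"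
      unfolding exp_ind by (simp add: ind R.prob_space)
    ultimately show ?thesis
      by (simp only:)
  qed
  ultimately have "l * ?p \<le> l * ?q + ?S / (2 * \<tau>\<^sup>2) + l\<^sup>2 / 8"
    by linarith
  then have "?p \<le> (l * ?q + ?S / (2 * \<tau>\<^sup>2) + l\<^sup>2 / 8) / l"
    using l by (simp add: pos_le_divide_eq mult.commute)
  also have "\<dots> = ?q + ?S / (2 * \<tau>\<^sup>2 * l) + l / 8"
    using l by (simp add: add_divide_distrib power2_eq_square)
  finally show ?thesis .
qed

section \<open>Clipped gradients and their dependence on the target\<close>

lemma norm_closest_point_cball_0_le:
  fixes x :: "'a::euclidean_space"
  assumes "R > 0"
  shows "norm (closest_point (cball 0 R) x) \<le> R"
  using closest_point_in_set[of "cball (0::'a) R" x] assms by simp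

lemma measurable_clipped_gradient:
  fixes f :: "'x \<Rightarrow> 'p::euclidean_space \<Rightarrow> real"
  assumes f: "parametric_model \<mu> f f'" and R: "R > 0"
  shows "(\<lambda>(x, \<theta>). closest_point (cball 0 R) (f' x \<theta>)) \<in> borel_measurable (\<mu> \<Otimes>\<^sub>M borel)"
proof -
  have "closest_point (cball (0::'p) R) \<in> borel_measurable borel"
    using R by (intro borel_measurable_continuous_onI continuous_on_closest_point) auto
  from measurable_compose[OF _ this, of "\<lambda>(x, \<theta>). f' x \<theta>"] f show ?thesis
    by (simp add: parametric_model_def split_beta')
qed

lemma borel_measurable_population_gradient:
  fixes f :: "'x \<Rightarrow> 'p::euclidean_space \<Rightarrow> real"
  assumes \<mu>: "prob_space \<mu>" and f: "parametric_model \<mu> f f'" and h[measurable]: "h \<in> borel_measurable \<mu>" and R: "R > 0"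
  shows "population_gradient f f' R (data_law \<mu> h) \<in> borel_measurable borel"
proof -
  interpret prob_space \<mu> by fact
  note [measurable] = measurable_clipped_gradient[OF f R]
  have [measurable]: "(\<lambda>(x, \<theta>). f x \<theta>) \<in> borel_measurable (\<mu> \<Otimes>\<^sub>M borel)"
    using f by (simp add: parametric_model_def)
  have "(\<lambda>\<theta>. - (LINT x|\<mu>. (h x - f x \<theta>) *\<^sub>R closest_point (cball 0 R) (f' x \<theta>))) \<in> borel_measurable borel"
    by measurable
  then show ?thesis
    using population_gradient_data_law[OF f h R] by (simp cong: measurable_cong)
qed

text \<open>If the loss gradient fails to be integrable, both population gradients are 0 by the convention
  for the Bochner integral, so that the estimate needs no integrability of the model.\<close>

lemma norm_population_gradient_diff_le:
  fixes f :: "'x \<Rightarrow> 'p::euclidean_space \<Rightarrow> real"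
  assumes \<mu>: "prob_space \<mu>" and f: "parametric_model \<mu> f f'" and R: "R > 0"
    and h[measurable]: "h1 \<in> borel_measurable \<mu>" "h2 \<in> borel_measurable \<mu>"
    and b: "\<And>x. x \<in> space \<mu> \<Longrightarrow> \<bar>h2 x - h1 x\<bar> \<le> b"
  shows "norm (population_gradient f f' R (data_law \<mu> h1) \<theta> - population_gradient f f' R (data_law \<mu> h2) \<theta>)
    \<le> norm (LINT x|\<mu>. (h2 x - h1 x) *\<^sub>R closest_point (cball 0 R) (f' x \<theta>))"
proof -
  interpret prob_space \<mu> by fact
  note [measurable] = measurable_clipped_gradient[OF f R]
  let ?v = "\<lambda>x. closest_point (cball 0 R) (f' x \<theta>)"
  have diff: "integrable \<mu> (\<lambda>x. (h2 x - h1 x) *\<^sub>R ?v x)"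
  proof (rule integrable_const_bound)
    show "AE x in \<mu>. norm ((h2 x - h1 x) *\<^sub>R ?v x) \<le> b * R"
      using order_trans[OF abs_ge_zero b]
      by (auto intro!: mult_mono b norm_closest_point_cball_0_le R)
  qed measurable
  show ?thesis
  proof (cases "integrable \<mu> (\<lambda>x. (h1 x - f x \<theta>) *\<^sub>R ?v x)")
    case True
    have eq: "(\<lambda>x. (h2 x - f x \<theta>) *\<^sub>R ?v x) = (\<lambda>x. (h1 x - f x \<theta>) *\<^sub>R ?v x + (h2 x - h1 x) *\<^sub>R ?v x)"
      by (simp flip: scaleR_add_left)
    show ?thesis
      unfolding population_gradient_data_law[OF f h(1) R] population_gradient_data_law[OF f h(2) R]
        eq Bochner_Integration.integral_add[OF True diff]
      by simp
  next
    case False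
    have eq: "(\<lambda>x. (h1 x - f x \<theta>) *\<^sub>R ?v x) = (\<lambda>x. (h2 x - f x \<theta>) *\<^sub>R ?v x - (h2 x - h1 x) *\<^sub>R ?v x)"
      by (simp flip: scaleR_diff_left)
    have "\<not> integrable \<mu> (\<lambda>x. (h2 x - f x \<theta>) *\<^sub>R ?v x)"
      using False Bochner_Integration.integrable_diff[OF _ diff] unfolding eq by blast
    with False show ?thesis
      by (simp add: population_gradient_data_law[OF f _ R] not_integrable_integral_eq)
  qed
qed

subsection \<open>Alignment\<close>

lemma (in prob_space) L2_imp_integrable:
  assumes "u \<in> L2 M"
  shows "integrable M u"
proof (rule Bochner_Integration.integrable_bound)
  show "integrable M (\<lambda>x. 1 + (u x)\<^sup>2)" "u \<in> borel_measurable M"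
    using assms by (auto simp: L2_def)
  have "\<bar>u x\<bar> \<le> 1 + (u x)\<^sup>2" for x
    using sum_squares_bound[of 1 "\<bar>u x\<bar>"] by simp
  then show "AE x in M. norm (u x) \<le> norm (1 + (u x)\<^sup>2)"
    by simp
qed

lemma (in prob_space) bounded_imp_L2:
  assumes "u \<in> borel_measurable M" and b: "\<And>x. x \<in> space M \<Longrightarrow> \<bar>u x\<bar> \<le> b"
  shows "u \<in> L2 M"
proof -
  have "AE x in M. norm ((u x)\<^sup>2) \<le> b\<^sup>2"
    using b by (auto intro!: AE_I2 simp: abs_le_square_iff[symmetric] order_trans[OF _ abs_ge_self])
  then show ?thesis
    using assms(1) unfolding L2_def by (auto intro!: integrable_const_bound[of _ "b\<^sup>2"])
qed

lemma L2_norm_power2: "(L2_norm M u)\<^sup>2 = (LINT x|M. (u x)\<^sup>2)"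
  by (simp add: L2_norm_def L2_inner_def power2_eq_square)

text \<open>Turns a norm bound, meaningful only together with membership in \<open>L2\<close>, into
  one inequality between extended nonnegative numbers. In that form the success event is measurable
  and can be transferred between laws.\<close>

lemma nn_integral_power2_le_iff:
  assumes "u \<in> borel_measurable M" and "c \<ge> 0"
  shows "(\<integral>\<^sup>+x. ennreal ((u x)\<^sup>2) \<partial>M) \<le> ennreal c \<longleftrightarrow> u \<in> L2 M \<and> (L2_norm M u)\<^sup>2 \<le> c"
proof (cases "integrable M (\<lambda>x. (u x)\<^sup>2)")
  case True
  then show ?thesis
    using assms by (simp add: nn_integral_eq_integral L2_def L2_norm_power2)
next
  case False
  have "\<not> (\<integral>\<^sup>+x. ennreal ((u x)\<^sup>2) \<partial>M) \<le> ennreal c"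
  proof
    assume "(\<integral>\<^sup>+x. ennreal ((u x)\<^sup>2) \<partial>M) \<le> ennreal c"
    then have "(\<integral>\<^sup>+x. ennreal ((u x)\<^sup>2) \<partial>M) < \<infinity>"
      by (rule le_less_trans) simp
    with assms(1) False show False
      by (auto intro!: integrableI_nonneg)
  qed
  with False show ?thesis
    by (simp add: L2_def)
qed

text \<open>Here \<open>g\<close> is a random parameter of a jointly measurable family of maps. The
  group laws, the invariance of \<open>\<mu>\<close> and that of \<open>h0\<close> enter when the
  success probability and the margin are compared across different \<open>g\<close>.\<close>

locale signed_alignment = \<mu>: prob_space \<mu> + \<nu>: prob_space \<nu>
  for \<mu> :: "'x measure" and \<nu> :: "'g measure" +
  fixes act :: "'g \<Rightarrow> 'x \<Rightarrow> 'x" and h h0 :: "'x \<Rightarrow> real"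
  assumes measurable_act [measurable]: "(\<lambda>(g, x). act g x) \<in> \<nu> \<Otimes>\<^sub>M \<mu> \<rightarrow>\<^sub>M \<mu>"
    and measurable_h [measurable]: "h \<in> borel_measurable \<mu>" and h: "h \<in> space \<mu> \<rightarrow> {-1, 1}"
    and measurable_h0 [measurable]: "h0 \<in> borel_measurable \<mu>" and h0: "h0 \<in> space \<mu> \<rightarrow> {-1, 1}"
begin

definition \<Delta> :: "'g \<Rightarrow> 'x \<Rightarrow> real" where
  "\<Delta> g x = h (act g x) - h0 x"

abbreviation A :: real where
  "A \<equiv> alignment \<nu> \<mu> act h h0"

lemma measurable_act_section: "g \<in> space \<nu> \<Longrightarrow> act g \<in> \<mu> \<rightarrow>\<^sub>M \<mu>"
  using measurable_compose[OF measurable_Pair1' measurable_act, of g] by simp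

lemma measurable_\<Delta> [measurable]: "(\<lambda>(g, x). \<Delta> g x) \<in> borel_measurable (\<nu> \<Otimes>\<^sub>M \<mu>)"
  unfolding \<Delta>_def by measurable

lemma abs_\<Delta>_le:
  assumes "g \<in> space \<nu>" "x \<in> space \<mu>"
  shows "\<bar>\<Delta> g x\<bar> \<le> 2"
proof -
  have "h (act g x) \<in> {-1, 1}" "h0 x \<in> {-1, 1}"
    using h h0 measurable_space[OF measurable_act_section] assms by blast+
  then show ?thesis by (auto simp: \<Delta>_def)
qed

lemma \<Delta>_L2: "g \<in> space \<nu> \<Longrightarrow> \<Delta> g \<in> L2 \<mu>"
  by (rule \<mu>.bounded_imp_L2[OF _ abs_\<Delta>_le]) measurable

lemma integrable_\<Delta>_mult:
  assumes "u \<in> L2 \<mu>" "g \<in> space \<nu>"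
  shows "integrable \<mu> (\<lambda>x. \<Delta> g x * u x)"
proof (rule Bochner_Integration.integrable_bound)
  show "integrable \<mu> (\<lambda>x. 2 * u x)"
    using \<mu>.L2_imp_integrable[OF assms(1)] by simp
  note [measurable] = assms(2)
  have [measurable]: "u \<in> borel_measurable \<mu>"
    using assms by (simp add: L2_def)
  show "(\<lambda>x. \<Delta> g x * u x) \<in> borel_measurable \<mu>"
    by measurable
  show "AE x in \<mu>. norm (\<Delta> g x * u x) \<le> norm (2 * u x)"
    using abs_\<Delta>_le[OF assms(2)] by (auto intro!: AE_I2 mult_right_mono simp: abs_mult)
qed

text \<open>A crude substitute for Cauchy-Schwarz, from
  \<open>2 * \<bar>y\<bar> \<le> 1 + y\<^sup>2\<close> and the bound 2 on \<open>\<Delta>\<close>.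
  It serves for integrability and for finiteness of the alignment.\<close>

lemma abs_L2_inner_\<Delta>_le:
  assumes u: "u \<in> L2 \<mu>" and g: "g \<in> space \<nu>"
  shows "\<bar>L2_inner \<mu> (\<Delta> g) u\<bar> \<le> 1 + (L2_norm \<mu> u)\<^sup>2"
proof -
  have int: "integrable \<mu> (\<lambda>x. (u x)\<^sup>2)"
    using u by (simp add: L2_def)
  have "\<bar>L2_inner \<mu> (\<Delta> g) u\<bar> \<le> (LINT x|\<mu>. \<bar>\<Delta> g x * u x\<bar>)"
    unfolding L2_inner_def by (rule integral_abs_bound)
  also have "\<dots> \<le> (LINT x|\<mu>. 1 + (u x)\<^sup>2)"
  proof (rule integral_mono)
    fix x assume "x \<in> space \<mu>"
    then have "\<bar>\<Delta> g x * u x\<bar> \<le> 2 * \<bar>u x\<bar>"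
      using abs_\<Delta>_le[OF g] by (auto simp: abs_mult intro!: mult_right_mono)
    also have "\<dots> \<le> 1 + (u x)\<^sup>2"
      using sum_squares_bound[of 1 "\<bar>u x\<bar>"] by simp
    finally show "\<bar>\<Delta> g x * u x\<bar> \<le> 1 + (u x)\<^sup>2" .
  qed (use int integrable_\<Delta>_mult[OF u g] in auto)
  finally show ?thesis
    using int by (simp add: L2_norm_power2 \<mu>.prob_space)
qed

lemma integrable_L2_inner_\<Delta>_power2:
  assumes "u \<in> L2 \<mu>"
  shows "integrable \<nu> (\<lambda>g. (L2_inner \<mu> (\<Delta> g) u)\<^sup>2)"
proof (rule \<nu>.integrable_const_bound)
  have [measurable]: "u \<in> borel_measurable \<mu>"
    using assms by (simp add: L2_def)
  show "(\<lambda>g. (L2_inner \<mu> (\<Delta> g) u)\<^sup>2) \<in> borel_measurable \<nu>"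
    unfolding L2_inner_def by measurable
  show "AE g in \<nu>. norm ((L2_inner \<mu> (\<Delta> g) u)\<^sup>2) \<le> (1 + (L2_norm \<mu> u)\<^sup>2)\<^sup>2"
    using abs_L2_inner_\<Delta>_le[OF assms] power_mono[OF _ abs_ge_zero, of _ _ 2] by (fastforce intro!: AE_I2)
qed

lemma integral_L2_inner_\<Delta>_le_unit:
  assumes "\<phi> \<in> L2 \<mu>" "L2_norm \<mu> \<phi> = 1"
  shows "(LINT g|\<nu>. (L2_inner \<mu> (\<Delta> g) \<phi>)\<^sup>2) \<le> A"
proof -
  have "(LINT g|\<nu>. (L2_inner \<mu> (\<Delta> g) u)\<^sup>2) \<le> 4" if "u \<in> L2 \<mu>" "L2_norm \<mu> u = 1" for u
    using abs_L2_inner_\<Delta>_le[OF that(1)] that(2) power_mono[OF _ abs_ge_zero, of _ 2 2]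
    by (intro \<nu>.integral_le_const integrable_L2_inner_\<Delta>_power2[OF that(1)]) (fastforce intro!: AE_I2)
  \<comment> \<open>A real supremum dominates its members only when the set is bounded above. On
    unit vectors the correlation is at most 2, hence the 4.\<close>
  then have "bdd_above ((\<lambda>\<phi>. LINT g|\<nu>. (L2_inner \<mu> (\<Delta> g) \<phi>)\<^sup>2) ` {\<phi> \<in> L2 \<mu>. L2_norm \<mu> \<phi> = 1})"
    by (auto intro!: bdd_aboveI[of _ 4])
  from cSUP_upper[OF _ this, of \<phi>] assms show ?thesis
    by (simp add: alignment_def \<Delta>_def[abs_def])
qed

lemma alignment_nonneg: "0 \<le> A"
proof -
  have "(\<lambda>_. 1) \<in> L2 \<mu>" "L2_norm \<mu> (\<lambda>_. 1) = 1"
    by (auto simp: L2_def L2_norm_def L2_inner_def \<mu>.prob_space)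
  from integral_L2_inner_\<Delta>_le_unit[OF this] show ?thesis
    by (rule order_trans[rotated]) simp
qed

lemma integral_L2_inner_\<Delta>_le:
  assumes u: "u \<in> L2 \<mu>"
  shows "(LINT g|\<nu>. (L2_inner \<mu> (\<Delta> g) u)\<^sup>2) \<le> A * (L2_norm \<mu> u)\<^sup>2"
proof (cases "L2_norm \<mu> u = 0")
  case True
  have "integrable \<mu> (\<lambda>x. (u x)\<^sup>2)" "u \<in> borel_measurable \<mu>"
    using u by (auto simp: L2_def)
  moreover have "(LINT x|\<mu>. (u x)\<^sup>2) = 0"
    using True by (simp flip: L2_norm_power2)
  ultimately have "AE x in \<mu>. u x = 0"
    by (subst (asm) integral_nonneg_eq_0_iff_AE) auto
  then have "L2_inner \<mu> (\<Delta> g) u = 0" for g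
    unfolding L2_inner_def by (intro integral_eq_zero_AE) auto
  then show ?thesis
    by (simp add: True)
next
  case False
  define n where "n = L2_norm \<mu> u"
  have "(LINT x|\<mu>. (u x)\<^sup>2) = n\<^sup>2" "n > 0"
    using False L2_norm_power2[of \<mu> u] by (auto simp: n_def L2_norm_def less_le L2_inner_def)
  then have "L2_norm \<mu> (\<lambda>x. u x / n) = 1"
    by (simp add: L2_norm_def L2_inner_def power_divide flip: power2_eq_square)
  moreover have "(\<lambda>x. u x / n) \<in> L2 \<mu>"
    using u by (auto simp: L2_def power_divide)
  ultimately have "(LINT g|\<nu>. (L2_inner \<mu> (\<Delta> g) (\<lambda>x. u x / n))\<^sup>2) \<le> A"
    by (intro integral_L2_inner_\<Delta>_le_unit)
  then show ?thesis
    using \<open>n > 0\<close> by (simp add: L2_inner_def power_divide pos_divide_le_eq n_def[symmetric])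
qed

lemma norm_integral_scaleR_\<Delta>_power2_le:
  fixes v :: "'x \<Rightarrow> 'p::euclidean_space"
  assumes "v \<in> borel_measurable \<mu>" and v: "\<And>x. norm (v x) \<le> R" and g: "g \<in> space \<nu>"
  shows "(norm (LINT x|\<mu>. \<Delta> g x *\<^sub>R v x))\<^sup>2 \<le> (2 * R)\<^sup>2"
proof -
  have "norm (LINT x|\<mu>. \<Delta> g x *\<^sub>R v x) \<le> (LINT x|\<mu>. norm (\<Delta> g x *\<^sub>R v x))"
    by (rule integral_norm_bound)
  \<comment> \<open>The indicator is inserted because the next bound is required at every point,
    while \<open>\<Delta>\<close> is bounded only on the space of \<open>\<mu>\<close>.\<close>
  also have "\<dots> = \<bar>LINT x|\<mu>. norm (\<Delta> g x *\<^sub>R v x) * indicator (space \<mu>) x\<bar>"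
    by (subst abs_of_nonneg) (auto intro!: Bochner_Integration.integral_cong)
  also have "\<dots> \<le> 2 * R"
    using abs_\<Delta>_le[OF g] v order_trans[OF norm_ge_zero v]
    by (intro \<mu>.abs_expectation_le) (auto simp: indicator_def intro!: mult_mono)
  finally show ?thesis
    by (intro power_mono) auto
qed

text \<open>Each coordinate of \<open>v\<close> is a scalar test function for the alignment, and the
  squared \<open>L2\<close> norms of the coordinates add up to that of \<open>v\<close>. Hence no
  dimension factor appears.\<close>

lemma integral_norm_integral_scaleR_\<Delta>_le:
  fixes v :: "'x \<Rightarrow> 'p::euclidean_space"
  assumes [measurable]: "v \<in> borel_measurable \<mu>" and v: "\<And>x. norm (v x) \<le> R"
  shows "(LINT g|\<nu>. (norm (LINT x|\<mu>. \<Delta> g x *\<^sub>R v x))\<^sup>2) \<le> A * R\<^sup>2"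
proof -
  have vb: "(\<lambda>x. v x \<bullet> b) \<in> L2 \<mu>" if "b \<in> Basis" for b
    using order_trans[OF Basis_le_norm[OF that] v] by (intro \<mu>.bounded_imp_L2[where b = R]) auto
  have eq: "(norm (LINT x|\<mu>. \<Delta> g x *\<^sub>R v x))\<^sup>2 = (\<Sum>b\<in>Basis. (L2_inner \<mu> (\<Delta> g) (\<lambda>x. v x \<bullet> b))\<^sup>2)"
    if g: "g \<in> space \<nu>" for g
  proof -
    have "integrable \<mu> (\<lambda>x. \<Delta> g x *\<^sub>R v x)"
      using abs_\<Delta>_le[OF g] v order_trans[OF norm_ge_zero v] g
      by (intro \<mu>.integrable_const_bound[of _ "2 * R"]) (auto intro!: AE_I2 mult_mono)
    then have "(LINT x|\<mu>. \<Delta> g x *\<^sub>R v x) \<bullet> b = L2_inner \<mu> (\<Delta> g) (\<lambda>x. v x \<bullet> b)" for b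
      by (simp add: L2_inner_def flip: integral_inner_left)
    then show ?thesis
      unfolding power2_norm_eq_inner by (subst euclidean_inner) (simp add: power2_eq_square)
  qed
  have "(LINT g|\<nu>. (norm (LINT x|\<mu>. \<Delta> g x *\<^sub>R v x))\<^sup>2) =
      (\<Sum>b\<in>Basis. LINT g|\<nu>. (L2_inner \<mu> (\<Delta> g) (\<lambda>x. v x \<bullet> b))\<^sup>2)"
    using integrable_L2_inner_\<Delta>_power2[OF vb]
    by (simp add: eq cong: Bochner_Integration.integral_cong)
  also have "\<dots> \<le> (\<Sum>b\<in>Basis. A * (L2_norm \<mu> (\<lambda>x. v x \<bullet> b))\<^sup>2)"
    by (intro sum_mono integral_L2_inner_\<Delta>_le vb)
  also have "\<dots> = A * (LINT x|\<mu>. (\<Sum>b\<in>Basis. (v x \<bullet> b)\<^sup>2))"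
    using vb by (simp add: L2_norm_power2 L2_def sum_distrib_left)
  also have "(\<lambda>x. \<Sum>b\<in>Basis. (v x \<bullet> b)\<^sup>2) = (\<lambda>x. (norm (v x))\<^sup>2)"
    unfolding power2_norm_eq_inner by (subst (2) euclidean_inner) (simp add: power2_eq_square)
  also have "(LINT x|\<mu>. (norm (v x))\<^sup>2) \<le> R\<^sup>2"
  proof -
    have "\<bar>LINT x|\<mu>. (norm (v x))\<^sup>2\<bar> \<le> R\<^sup>2"
      using v by (intro \<mu>.abs_expectation_le) (auto intro!: power_mono)
    then show ?thesis by simp
  qed
  finally show ?thesis
    using alignment_nonneg by (simp add: mult_left_mono)
qed

text \<open>With \<open>u = w - h0\<close>, a fit by margin \<open>\<epsilon>\<close> says that
  \<open>u\<close> is closer to \<open>\<Delta> g\<close> than 0 is. Expanding the square bounds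
  their inner product below by \<open>(\<epsilon> + a) / 2\<close>, with \<open>a\<close> the
  squared norm of \<open>u\<close>; by the arithmetic-geometric mean inequality its square is at
  least \<open>\<epsilon> * a\<close>. As \<open>u\<close> is independent of \<open>g\<close>,
  Markov's inequality applies and \<open>a\<close> cancels.\<close>

lemma measure_fit_le:
  assumes [measurable]: "w \<in> borel_measurable \<mu>" and \<epsilon>: "\<epsilon> > 0"
    and c: "c \<ge> 0" "\<And>g. g \<in> space \<nu> \<Longrightarrow> c \<le> (L2_norm \<mu> (\<Delta> g))\<^sup>2 - \<epsilon>"
  shows "measure \<nu> {g \<in> space \<nu>. (\<integral>\<^sup>+x. ennreal ((w x - h (act g x))\<^sup>2) \<partial>\<mu>) \<le> ennreal c} \<le> A / \<epsilon>"
    (is "measure \<nu> ?E \<le> _")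
proof (cases "?E = {}")
  case True
  then show ?thesis
    using alignment_nonneg \<epsilon> by (simp only: True measure_empty) simp
next
  case False
  define u where "u x = w x - h0 x" for x
  have [measurable]: "?E \<in> sets \<nu>"
    by measurable
  have fit: "(\<lambda>x. u x - \<Delta> g x) \<in> L2 \<mu> \<and> (L2_norm \<mu> (\<lambda>x. u x - \<Delta> g x))\<^sup>2 \<le> (L2_norm \<mu> (\<Delta> g))\<^sup>2 - \<epsilon>"
    if "g \<in> ?E" for g
  proof -
    have g: "g \<in> space \<nu>" using that by simp
    note [measurable] = g
    have eq: "u x - \<Delta> g x = w x - h (act g x)" for x
      by (simp add: u_def \<Delta>_def)
    have "(\<lambda>x. w x - h (act g x)) \<in> borel_measurable \<mu>"
      by measurable
    from nn_integral_power2_le_iff[OF this c(1)] that c(2)[OF g] show ?thesis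
      unfolding eq by auto
  qed
  \<comment> \<open>The model output is not assumed square-integrable. A single \<open>g\<close> in
    \<open>?E\<close> suffices: \<open>u\<close> is an \<open>L2\<close> function plus the bounded
    \<open>\<Delta> g\<close>.\<close>
  have uL2: "u \<in> L2 \<mu>"
  proof -
    obtain g where g: "g \<in> ?E" using False by blast
    then have g': "g \<in> space \<nu>" by simp
    have [measurable]: "u \<in> borel_measurable \<mu>"
      unfolding u_def by measurable
    have "integrable \<mu> (\<lambda>x. 2 * (u x - \<Delta> g x)\<^sup>2 + 2 * (\<Delta> g x)\<^sup>2)"
      using fit[OF g] \<Delta>_L2[OF g'] by (auto simp: L2_def)
    then have "integrable \<mu> (\<lambda>x. (u x)\<^sup>2)"
    proof (rule Bochner_Integration.integrable_bound)
      have "(u x)\<^sup>2 \<le> 2 * (u x - \<Delta> g x)\<^sup>2 + 2 * (\<Delta> g x)\<^sup>2" for x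
        using zero_le_power2[of "u x - 2 * \<Delta> g x"] by (simp add: power2_eq_square algebra_simps)
      then show "AE x in \<mu>. norm ((u x)\<^sup>2) \<le> norm (2 * (u x - \<Delta> g x)\<^sup>2 + 2 * (\<Delta> g x)\<^sup>2)"
        by simp
    qed measurable
    then show ?thesis
      by (simp add: L2_def)
  qed
  define a where "a = (L2_norm \<mu> u)\<^sup>2"
  have corr: "(\<epsilon> + a) / 2 \<le> L2_inner \<mu> (\<Delta> g) u" if g: "g \<in> ?E" for g
  proof -
    have g': "g \<in> space \<nu>" using g by simp
    have "(LINT x|\<mu>. (u x - \<Delta> g x)\<^sup>2) = (LINT x|\<mu>. (u x)\<^sup>2 + (\<Delta> g x)\<^sup>2 - 2 * (\<Delta> g x * u x))"
      by (simp add: power2_eq_square algebra_simps)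
    also have "\<dots> = (LINT x|\<mu>. (u x)\<^sup>2) + (LINT x|\<mu>. (\<Delta> g x)\<^sup>2) - 2 * (LINT x|\<mu>. \<Delta> g x * u x)"
      using uL2 \<Delta>_L2[OF g'] integrable_\<Delta>_mult[OF uL2 g'] by (simp add: L2_def)
    finally show ?thesis
      using fit[OF g] by (simp add: a_def L2_norm_power2 L2_inner_def)
  qed
  have "a \<ge> 0"
    by (simp add: a_def)
  \<comment> \<open>Otherwise \<open>u\<close> vanishes almost everywhere, which contradicts its
    positive correlation with \<open>\<Delta> g\<close> for \<open>g\<close> in
    \<open>?E\<close>.\<close>
  have a_pos: "a > 0"
  proof (rule ccontr)
    assume "\<not> a > 0"
    with \<open>a \<ge> 0\<close> have "a = 0" by simp
    have "(L2_inner \<mu> (\<Delta> g) u) = 0" for g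
    proof -
      have "AE x in \<mu>. (u x)\<^sup>2 = 0"
        using uL2 \<open>a = 0\<close> by (subst integral_nonneg_eq_0_iff_AE[symmetric]) (auto simp: L2_def a_def L2_norm_power2)
      then show ?thesis
        using uL2 unfolding L2_inner_def by (intro integral_eq_zero_AE) auto
    qed
    with corr False \<epsilon> \<open>a = 0\<close> show False by fastforce
  qed
  have ind: "integrable \<nu> (indicator ?E :: 'g \<Rightarrow> real)"
    by (rule \<nu>.integrable_const_bound[of _ 1]) (auto simp: indicator_def)
  have "\<epsilon> * a * measure \<nu> ?E = (LINT g|\<nu>. \<epsilon> * a * indicator ?E g)"
    by (simp del: indicator_simps)
  also have "\<dots> \<le> (LINT g|\<nu>. (L2_inner \<mu> (\<Delta> g) u)\<^sup>2)"
  proof (rule integral_mono)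
    show "\<epsilon> * a * indicator ?E g \<le> (L2_inner \<mu> (\<Delta> g) u)\<^sup>2" for g
    proof (cases "g \<in> ?E")
      case True
      have "\<epsilon> * a \<le> ((\<epsilon> + a) / 2)\<^sup>2"
        using zero_le_power2[of "\<epsilon> - a"] by (simp add: power2_eq_square field_simps)
      also have "\<dots> \<le> (L2_inner \<mu> (\<Delta> g) u)\<^sup>2"
        using corr[OF True] \<epsilon> \<open>a \<ge> 0\<close> by (intro power_mono) auto
      finally show ?thesis
        using True by (simp del: mem_Collect_eq)
    qed (simp del: mem_Collect_eq)
  qed (use ind in \<open>auto intro: integrable_L2_inner_\<Delta>_power2[OF uL2] simp del: integrable_indicator_iff\<close>)
  also have "\<dots> \<le> A * a"
    unfolding a_def by (rule integral_L2_inner_\<Delta>_le[OF uL2])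
  finally show ?thesis
    using a_pos \<epsilon> by (simp add: pos_le_divide_eq mult.commute)
qed

end

section \<open>Optimising the free parameter and averaging over the group\<close>

lemma le_sqrt_of_le_divide_add:
  fixes x y z s t :: real
  assumes "\<And>l. l > 0 \<Longrightarrow> x \<le> y + s / (2 * t\<^sup>2 * l) + l / 8" and "s \<ge> 0" and "t > 0"
  shows "x \<le> y + sqrt s / (2 * t)"
proof (cases "s = 0")
  case True
  \<comment> \<open>The minimiser would be \<open>l = 0\<close>, which is excluded, so arbitrarily
    small \<open>l = 8 * e\<close> are used.\<close>
  have "x \<le> y + e" if "e > 0" for e
    using assms(1)[of "8 * e"] that True by simp
  then have "x \<le> y"
    by (rule field_le_epsilon)
  then show ?thesis
    using True by simp
next
  case False
  then have s: "sqrt s > 0" using assms(2) by simp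
  \<comment> \<open>At \<open>l = 2 * sqrt s / t\<close> the two terms in \<open>l\<close> coincide,
    each being \<open>sqrt s / (4 * t)\<close>.\<close>
  have "s / (2 * t\<^sup>2 * (2 * sqrt s / t)) = s / sqrt s / (4 * t)"
    using assms(3) by (simp add: power2_eq_square)
  also have "s / sqrt s = sqrt s"
    using assms(2) by (rule real_div_sqrt)
  finally show ?thesis
    using assms(1)[of "2 * sqrt s / t"] s assms(3) by simp
qed

context signed_alignment begin

text \<open>\<open>p\<close> stands for a success probability common to all \<open>g\<close>.
  Integrating over \<open>g\<close> leaves it unchanged, while on the right both averages become
  integrals along the \<open>h0\<close>-trajectory.\<close>

lemma averaged_learning_bound:
  fixes f :: "'x \<Rightarrow> 'p::euclidean_space \<Rightarrow> real"
  assumes \<mu>0: "prob_space \<mu>0" "sets \<mu>0 = sets borel"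
    and f: "parametric_model \<mu> f f'" and \<tau>: "\<tau> > 0" and R: "R > 0" and \<epsilon>: "\<epsilon> > 0"
    and c: "c \<ge> 0" "\<And>g. g \<in> space \<nu> \<Longrightarrow> c \<le> (L2_norm \<mu> (\<Delta> g))\<^sup>2 - \<epsilon>"
    and p: "\<And>g. g \<in> space \<nu> \<Longrightarrow> p \<le> measure (gd_randomness \<mu>0 \<tau>) {\<omega> \<in> space (gd_randomness \<mu>0 \<tau>).
      (\<integral>\<^sup>+x. ennreal ((f x (gd_iterate f f' R \<eta> (data_law \<mu> (\<lambda>x. h (act g x))) \<omega> T) - h (act g x))\<^sup>2) \<partial>\<mu>)
        \<le> ennreal c}"
  shows "p \<le> R / (2 * \<tau>) * sqrt (real T * A) + A / \<epsilon>"
proof -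
  let ?R = "gd_randomness \<mu>0 \<tau>"
  let ?hg = "\<lambda>g x. h (act g x)"
  let ?v = "\<lambda>x \<theta>. closest_point (cball 0 R) (f' x \<theta>)"
  let ?gd = "gd_iterate f f' R \<eta> (data_law \<mu> h0)"
  interpret R: prob_space ?R
    by (rule prob_space_gd_randomness[OF \<mu>0(1) \<tau>])
  interpret \<nu>R: pair_prob_space \<nu> ?R ..
  note [measurable] = measurable_clipped_gradient[OF f R]
  have [measurable]: "(\<lambda>(x, \<theta>). f x \<theta>) \<in> borel_measurable (\<mu> \<Otimes>\<^sub>M borel)"
    using f by (simp add: parametric_model_def)
  have hg[measurable]: "?hg g \<in> borel_measurable \<mu>" if "g \<in> space \<nu>" for g
    using that by measurable
  note pg = borel_measurable_population_gradient[OF \<mu>.prob_space_axioms f _ R]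
  have [measurable]: "(\<lambda>\<omega>. ?gd \<omega> k) \<in> borel_measurable ?R" for k
    by (rule borel_measurable_gd_iterate[OF pg[OF measurable_h0] \<mu>0(2)])
  define \<delta> where "\<delta> g \<theta> = (norm (LINT x|\<mu>. \<Delta> g x *\<^sub>R ?v x \<theta>))\<^sup>2" for g \<theta>
  have [measurable]: "(\<lambda>(g, \<theta>). \<delta> g \<theta>) \<in> borel_measurable (\<nu> \<Otimes>\<^sub>M borel)"
    unfolding \<delta>_def by measurable
  have v_meas: "(\<lambda>x. ?v x \<theta>) \<in> borel_measurable \<mu>" for \<theta>
    by measurable
  note v_bound = norm_closest_point_cball_0_le[OF R]
  have \<delta>_bound: "\<delta> g \<theta> \<le> (2 * R)\<^sup>2" if "g \<in> space \<nu>" for g \<theta>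
    unfolding \<delta>_def by (rule norm_integral_scaleR_\<Delta>_power2_le[OF v_meas v_bound that])
  have \<delta>_nonneg: "0 \<le> \<delta> g \<theta>" for g \<theta>
    by (simp add: \<delta>_def)
  define B where "B g = {\<theta>. (\<integral>\<^sup>+x. ennreal ((f x \<theta> - ?hg g x)\<^sup>2) \<partial>\<mu>) \<le> ennreal c}" for g
  have B_meas[measurable]: "B g \<in> sets borel" if [measurable]: "g \<in> space \<nu>" for g
  proof -
    have "{\<theta> \<in> space borel. (\<integral>\<^sup>+x. ennreal ((f x \<theta> - ?hg g x)\<^sup>2) \<partial>\<mu>) \<le> ennreal c} \<in> sets borel"
      by measurable
    then show ?thesis by (simp add: B_def)
  qed
  define q where "q g = measure ?R {\<omega> \<in> space ?R. ?gd \<omega> T \<in> B g}" for g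
  define S where "S g = (\<Sum>k<T. LINT \<omega>|?R. \<delta> g (?gd \<omega> k))" for g
  \<comment> \<open>Sections of \<open>E\<close> at fixed \<open>g\<close> have probability
    \<open>q g\<close>; sections at fixed \<open>\<omega>\<close> consist of the \<open>g\<close>
    fitted by one fixed parameter, so Fubini brings in \<open>measure_fit_le\<close>.\<close>
  define E where "E = {z \<in> space (\<nu> \<Otimes>\<^sub>M ?R). ?gd (snd z) T \<in> B (fst z)}"
  have E_meas[measurable]: "E \<in> sets (\<nu> \<Otimes>\<^sub>M ?R)"
    unfolding E_def B_def mem_Collect_eq by measurable
  have ind_E: "integrable (\<nu> \<Otimes>\<^sub>M ?R) (indicator E :: _ \<Rightarrow> real)"
    by (rule \<nu>R.P.integrable_const_bound[of _ 1]) (auto simp: indicator_def)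
  have sec1: "(LINT \<omega>|?R. indicator E (g, \<omega>)) = q g" if "g \<in> space \<nu>" for g
  proof -
    have "(LINT \<omega>|?R. indicator E (g, \<omega>)) = (LINT \<omega>|?R. indicator {\<omega> \<in> space ?R. ?gd \<omega> T \<in> B g} \<omega> :: real)"
      using that by (intro Bochner_Integration.integral_cong) (auto simp: indicator_def E_def space_pair_measure)
    then show ?thesis
      by (simp add: q_def Int_def conj_commute cong: conj_cong)
  qed
  have sec2: "(LINT g|\<nu>. indicator E (g, \<omega>)) \<le> A / \<epsilon>" if "\<omega> \<in> space ?R" for \<omega>
  proof -
    let ?E = "{g \<in> space \<nu>. (\<integral>\<^sup>+x. ennreal ((f x (?gd \<omega> T) - ?hg g x)\<^sup>2) \<partial>\<mu>) \<le> ennreal c}"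
    have "(LINT g|\<nu>. indicator E (g, \<omega>)) = (LINT g|\<nu>. indicator ?E g :: real)"
      using that by (intro Bochner_Integration.integral_cong) (auto simp: indicator_def E_def B_def space_pair_measure)
    also have "\<dots> = measure \<nu> ?E"
      by (simp add: Int_def conj_commute cong: conj_cong)
    also have "\<dots> \<le> A / \<epsilon>"
      by (rule measure_fit_le[OF _ \<epsilon> c]) measurable
    finally show ?thesis .
  qed
  have q_int: "integrable \<nu> q"
    using \<nu>R.integrable_fst'[OF ind_E] sec1 by (simp cong: Bochner_Integration.integrable_cong)
  have q_le: "(LINT g|\<nu>. q g) \<le> A / \<epsilon>"
  proof -
    have "(LINT g|\<nu>. q g) = (LINT g|\<nu>. LINT \<omega>|?R. indicator E (g, \<omega>))"
      by (simp add: sec1 cong: Bochner_Integration.integral_cong)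
    also have "\<dots> = (LINT \<omega>|?R. LINT g|\<nu>. indicator E (g, \<omega>))"
      using \<nu>R.Fubini_integral[of "\<lambda>g \<omega>. indicator E (g, \<omega>) :: real"] ind_E by simp
    also have "\<dots> \<le> A / \<epsilon>"
      using \<nu>R.integrable_snd[of "\<lambda>g \<omega>. indicator E (g, \<omega>) :: real"] ind_E sec2
      by (intro R.integral_le_const) (auto intro!: AE_I2)
    finally show ?thesis .
  qed
  have \<delta>_int: "integrable (\<nu> \<Otimes>\<^sub>M ?R) (\<lambda>(g, \<omega>). \<delta> g (?gd \<omega> k))" for k
  proof (rule \<nu>R.P.integrable_const_bound)
    show "AE z in \<nu> \<Otimes>\<^sub>M ?R. norm (case z of (g, \<omega>) \<Rightarrow> \<delta> g (?gd \<omega> k)) \<le> (2 * R)\<^sup>2"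
      using \<delta>_bound \<delta>_nonneg by (auto intro!: AE_I2 simp: space_pair_measure)
  qed measurable
  have S_int: "integrable \<nu> S"
    unfolding S_def using \<nu>R.integrable_fst'[OF \<delta>_int] by simp
  have S_le: "(LINT g|\<nu>. S g) \<le> real T * (A * R\<^sup>2)"
  proof -
    have "(LINT g|\<nu>. S g) = (\<Sum>k<T. LINT g|\<nu>. LINT \<omega>|?R. \<delta> g (?gd \<omega> k))"
      unfolding S_def using \<nu>R.integrable_fst'[OF \<delta>_int] by simp
    also have "\<dots> = (\<Sum>k<T. LINT \<omega>|?R. LINT g|\<nu>. \<delta> g (?gd \<omega> k))"
      using \<nu>R.Fubini_integral[OF \<delta>_int] by simp
    also have "\<dots> \<le> (\<Sum>k<T. A * R\<^sup>2)"
      using \<nu>R.integrable_snd[OF \<delta>_int] integral_norm_integral_scaleR_\<Delta>_le[OF v_meas v_bound]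
      by (intro sum_mono R.integral_le_const) (auto intro!: AE_I2 simp: \<delta>_def)
    finally show ?thesis by simp
  qed
  have "p \<le> A / \<epsilon> + (real T * (A * R\<^sup>2)) / (2 * \<tau>\<^sup>2 * l) + l / 8" if l: "l > 0" for l
  proof -
    have "p \<le> q g + S g / (2 * \<tau>\<^sup>2 * l) + l / 8" if g: "g \<in> space \<nu>" for g
    proof -
      \<comment> \<open>The \<open>h0\<close>-trajectory takes the place of \<open>D\<close> in the
        Pinsker bound, so that \<open>S g\<close> is computed along it.\<close>
      have close: "(norm (population_gradient f f' R (data_law \<mu> h0) \<theta> -
          population_gradient f f' R (data_law \<mu> (?hg g)) \<theta>))\<^sup>2 \<le> \<delta> g \<theta>" for \<theta>
        using norm_population_gradient_diff_le[OF \<mu>.prob_space_axioms f R measurable_h0 hg[OF g], of 2 \<theta>]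
          abs_\<Delta>_le[OF g] by (auto simp: \<delta>_def \<Delta>_def intro!: power_mono)
      have \<delta>_meas: "\<delta> g \<in> borel_measurable borel"
        using g by measurable
      show ?thesis
        using gd_iterate_pinsker[OF \<mu>0 \<tau> pg[OF measurable_h0] pg[OF hg[OF g]] \<delta>_meas close \<delta>_bound[OF g] B_meas[OF g] l, of \<eta> T]
          p[OF g] by (simp add: q_def S_def B_def)
    qed
    then have "p \<le> (LINT g|\<nu>. q g + S g / (2 * \<tau>\<^sup>2 * l) + l / 8)"
      using q_int S_int by (intro \<nu>.integral_ge_const) (auto intro!: AE_I2)
    also have "\<dots> = (LINT g|\<nu>. q g) + (LINT g|\<nu>. S g) / (2 * \<tau>\<^sup>2 * l) + l / 8"
      using q_int S_int by (simp add: \<nu>.prob_space)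
    also have "\<dots> \<le> A / \<epsilon> + (real T * (A * R\<^sup>2)) / (2 * \<tau>\<^sup>2 * l) + l / 8"
      using l by (intro add_mono divide_right_mono q_le S_le) auto
    finally show ?thesis .
  qed
  \<comment> \<open>The root is taken only now, after averaging, with
    \<open>s = T * (A * R\<^sup>2)\<close> and \<open>t = \<tau>\<close>.\<close>
  from le_sqrt_of_le_divide_add[OF this _ \<tau>] show ?thesis
    using alignment_nonneg R by (simp add: real_sqrt_mult mult_ac)
qed

end

section \<open>Transfer of the success event by equivariance\<close>

theorem theorem3p6:
  fixes X :: "'d::euclidean_space set" and \<mu> :: "'d measure"
    and G :: "('g, 'm) monoid_scheme" and \<O> :: "'g topology" and \<nu> :: "'g measure"
    and act :: "'g \<Rightarrow> 'd \<Rightarrow> 'd"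
    and f :: "'d \<Rightarrow> 'p::euclidean_space \<Rightarrow> real" and f' :: "'d \<Rightarrow> 'p \<Rightarrow> 'p"
    and \<mu>0 :: "'p measure" and \<eta> :: "nat \<Rightarrow> real"
    and h h0 :: "'d \<Rightarrow> real" and T :: nat and \<tau> R \<epsilon> :: real
  assumes "prob_space \<mu>" and "sets \<mu> = sets (restrict_space borel X)"
    and "compact_group G \<O>" and "haar_prob_measure G \<O> \<nu>"
    and "group_action G X act"
    and "(\<lambda>(g, x). act g x) \<in> measurable (\<nu> \<Otimes>\<^sub>M \<mu>) \<mu>"
    and "\<And>g. g \<in> carrier G \<Longrightarrow> distr \<mu> \<mu> (act g) = \<mu>"
    and "parametric_model \<mu> f f'"
    and "prob_space \<mu>0" and "sets \<mu>0 = sets borel"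
    and "\<And>k. \<eta> k > 0"
    and "equivariant_algorithm G \<mu> act (gd_algorithm X f f' \<mu>0 \<eta> \<tau> R T)"
    and "h \<in> borel_measurable \<mu>" and "h \<in> X \<rightarrow> {-1, 1}"
    and "h0 \<in> borel_measurable \<mu>" and "h0 \<in> X \<rightarrow> {-1, 1}"
    and "\<And>g x. g \<in> carrier G \<Longrightarrow> x \<in> X \<Longrightarrow> h0 (act g x) = h0 x"
    and "T \<ge> 1" and "\<tau> > 0" and "R > 0" and "\<epsilon> > 0"
  shows "measure (gd_randomness \<mu>0 \<tau>)
      {\<omega> \<in> space (gd_randomness \<mu>0 \<tau>).
        let \<theta> = gd_iterate f f' R \<eta> (data_law \<mu> h) \<omega> T in
        (\<lambda>x. f x \<theta> - h x) \<in> L2 \<mu> \<and>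
        (L2_norm \<mu> (\<lambda>x. f x \<theta> - h x))\<^sup>2 \<le> (L2_norm \<mu> (\<lambda>x. h0 x - h x))\<^sup>2 - \<epsilon>}
    \<le> R / (2 * \<tau>) * sqrt (real T * alignment \<nu> \<mu> act h h0) + alignment \<nu> \<mu> act h h0 / \<epsilon>"
proof -
  let ?R = "gd_randomness \<mu>0 \<tau>" and ?hg = "\<lambda>g x. h (act g x)"
  let ?gd = "gd_iterate f f' R \<eta> (data_law \<mu> h)"
  define c where "c = (L2_norm \<mu> (\<lambda>x. h0 x - h x))\<^sup>2 - \<epsilon>"
  have space_\<mu>: "space \<mu> = X"
    using sets_eq_imp_space_eq[OF assms(2)] by (simp add: space_restrict_space)
  have "prob_space \<nu>" and sets_\<nu>: "sets \<nu> = sets (borel_of_topology \<O>)"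
    using assms(4) by (auto simp: haar_prob_measure_def)
  have space_\<nu>: "space \<nu> = carrier G"
    using sets_eq_imp_space_eq[OF sets_\<nu>] assms(3)
    by (simp add: borel_of_topology_def compact_group_def space_measure_of_conv)
  interpret signed_alignment \<mu> \<nu> act h h0
    by (intro signed_alignment.intro signed_alignment_axioms.intro assms(1) \<open>prob_space \<nu>\<close>)
       (use assms space_\<mu> in auto)
  interpret R: prob_space ?R
    by (rule prob_space_gd_randomness[OF assms(9) \<open>\<tau> > 0\<close>])
  interpret G: group_action G X act by fact
  have group: "group G"
    using assms(3) by (simp add: compact_group_def)
  have f[measurable]: "(\<lambda>(x, \<theta>). f x \<theta>) \<in> borel_measurable (\<mu> \<Otimes>\<^sub>M borel)"
    using assms(8) by (simp add: parametric_model_def)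
  note gd_meas = borel_measurable_gd_iterate[OF
      borel_measurable_population_gradient[OF assms(1,8) _ \<open>R > 0\<close>] assms(10)]
  have [measurable]: "(\<lambda>\<omega>. ?gd \<omega> T) \<in> borel_measurable ?R"
    by (rule gd_meas) fact
  have act[measurable]: "act g \<in> \<mu> \<rightarrow>\<^sub>M \<mu>" if "g \<in> carrier G" for g
    using that measurable_act_section space_\<nu> by simp
  have invariant: "(\<integral>\<^sup>+x. u (act g x) \<partial>\<mu>) = (\<integral>\<^sup>+x. u x \<partial>\<mu>)"
    if "g \<in> carrier G" "u \<in> borel_measurable \<mu>" for g and u :: "'d \<Rightarrow> ennreal"
    using nn_integral_distr[OF act, of g u] assms(7)[OF that(1)] that by simp
  show ?thesis
  proof (cases "c \<ge> 0")
    \<comment> \<open>A negative threshold makes the event empty. It is treated separately because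
      \<open>ennreal\<close> would round it up to 0.\<close>
    case False
    then have "\<not> (L2_norm \<mu> u)\<^sup>2 \<le> c" for u
      using zero_le_power2[of "L2_norm \<mu> u"] by linarith
    then show ?thesis
      using alignment_nonneg assms(19-21) by (simp add: Let_def c_def)
  next
    case True
    \<comment> \<open>Equality holds: composing \<open>h0 - h\<close> with \<open>g\<close>
      preserves its norm, and \<open>h0\<close> is invariant, so the result is
      \<open>\<Delta> g\<close> up to sign.\<close>
    have margin: "c \<le> (L2_norm \<mu> (\<Delta> g))\<^sup>2 - \<epsilon>" if g: "g \<in> space \<nu>" for g
    proof -
      have "(LINT x|\<mu>. (h0 x - h x)\<^sup>2) = (LINT x|distr \<mu> \<mu> (act g). (h0 x - h x)\<^sup>2)"
        using assms(7) g space_\<nu> by simp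
      also have "\<dots> = (LINT x|\<mu>. (h0 (act g x) - h (act g x))\<^sup>2)"
        using act g space_\<nu> by (intro integral_distr) auto
      also have "\<dots> = (LINT x|\<mu>. (\<Delta> g x)\<^sup>2)"
        using assms(17) g space_\<nu> space_\<mu>
        by (intro Bochner_Integration.integral_cong) (auto simp: \<Delta>_def power2_commute)
      finally show ?thesis
        by (simp add: c_def L2_norm_power2)
    qed
    have event: "{\<omega> \<in> space ?R. let \<theta> = ?gd \<omega> T in (\<lambda>x. f x \<theta> - h x) \<in> L2 \<mu> \<and> (L2_norm \<mu> (\<lambda>x. f x \<theta> - h x))\<^sup>2 \<le> c} =
      {\<omega> \<in> space ?R. (\<integral>\<^sup>+x. ennreal ((f x (?gd \<omega> T) - h x)\<^sup>2) \<partial>\<mu>) \<le> ennreal c}"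
      by (simp add: Let_def nn_integral_power2_le_iff True)
    have same: "measure ?R {\<omega> \<in> space ?R. (\<integral>\<^sup>+x. ennreal ((f x (?gd \<omega> T) - h x)\<^sup>2) \<partial>\<mu>) \<le> ennreal c} =
      measure ?R {\<omega> \<in> space ?R. (\<integral>\<^sup>+x. ennreal ((f x (gd_iterate f f' R \<eta> (data_law \<mu> (?hg g)) \<omega> T) - ?hg g x)\<^sup>2) \<partial>\<mu>)
        \<le> ennreal c}" if "g \<in> space \<nu>" for g
    proof -
      \<comment> \<open>Equivariance is applied at the inverse of \<open>g\<close>, since moving the
        inputs by the inverse is what turns the target \<open>h\<close> into
        \<open>h \<circ> g\<close>.\<close>
      have g: "g \<in> carrier G" and i: "inv\<^bsub>G\<^esub> g \<in> carrier G"
        using that space_\<nu> group by (auto intro: group.inv_closed)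
      let ?i = "inv\<^bsub>G\<^esub> g"
      let ?gdg = "gd_iterate f f' R \<eta> (data_law \<mu> (?hg g))"
      have i_g: "act ?i (act g x) = x" and g_i: "act g (act ?i x) = x" if "x \<in> X" for x
        using G.orbit_sym_aux[OF g that refl] G.orbit_sym_aux[OF i that refl] group.inv_inv[OF group g] by auto
      have in_X: "act ?i x \<in> X" if "x \<in> X" for x
        using G.element_image[OF i that refl] .
      note [measurable] = act[OF g] act[OF i]
      have [measurable]: "(\<lambda>\<omega>. ?gdg \<omega> T) \<in> borel_measurable ?R"
        by (rule gd_meas) measurable
      have shifted_law: "distr (data_law \<mu> h) (\<mu> \<Otimes>\<^sub>M borel) (\<lambda>(x, y). (act ?i x, y)) = data_law \<mu> (?hg g)"
      proof -
        have "distr (data_law \<mu> h) (\<mu> \<Otimes>\<^sub>M borel) (\<lambda>(x, y). (act ?i x, y)) =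
            distr \<mu> (\<mu> \<Otimes>\<^sub>M borel) (\<lambda>x. (act ?i x, h x))"
          unfolding data_law_def by (subst distr_distr) (auto simp: comp_def)
        also have "\<dots> = distr \<mu> (\<mu> \<Otimes>\<^sub>M borel) ((\<lambda>x. (x, ?hg g x)) \<circ> act ?i)"
          by (intro distr_cong) (auto simp: g_i space_\<mu>)
        also have "\<dots> = distr (distr \<mu> \<mu> (act ?i)) (\<mu> \<Otimes>\<^sub>M borel) (\<lambda>x. (x, ?hg g x))"
          by (intro distr_distr[symmetric]) measurable
        finally show ?thesis
          by (simp add: data_law_def assms(7)[OF i])
      qed
      have law: "distr ?R (\<Pi>\<^sub>M x\<in>space \<mu>. borel) (\<lambda>\<omega>. \<lambda>x\<in>space \<mu>. f x (?gd \<omega> T)) =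
          distr ?R (\<Pi>\<^sub>M x\<in>space \<mu>. borel) (\<lambda>\<omega>. \<lambda>x\<in>space \<mu>. f (act ?i x) (?gdg \<omega> T))"
      proof -
        have "h \<in> borel_measurable \<mu> \<inter> (space \<mu> \<rightarrow> {-1, 1})"
          using assms(13,14) space_\<mu> by simp
        then have "gd_algorithm X f f' \<mu>0 \<eta> \<tau> R T (data_law \<mu> h) =
            distr (gd_algorithm X f f' \<mu>0 \<eta> \<tau> R T (data_law \<mu> (?hg g))) (\<Pi>\<^sub>M x\<in>space \<mu>. borel)
              (\<lambda>F. \<lambda>x\<in>space \<mu>. F (act ?i x))"
          using assms(12) i unfolding equivariant_algorithm_def Let_def shifted_law[symmetric] by blast
        also have "\<dots> = distr ?R (\<Pi>\<^sub>M x\<in>space \<mu>. borel)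
            ((\<lambda>F. \<lambda>x\<in>space \<mu>. F (act ?i x)) \<circ> (\<lambda>\<omega>. \<lambda>x\<in>X. f x (?gdg \<omega> T)))"
          unfolding gd_algorithm_def
        proof (rule distr_distr)
          show "(\<lambda>F. \<lambda>x\<in>space \<mu>. F (act ?i x)) \<in> (\<Pi>\<^sub>M x\<in>X. borel) \<rightarrow>\<^sub>M (\<Pi>\<^sub>M x\<in>space \<mu>. borel :: real measure)"
            using in_X by (intro measurable_restrict measurable_component_singleton) (simp add: space_\<mu>)
          show "(\<lambda>\<omega>. \<lambda>x\<in>X. f x (?gdg \<omega> T)) \<in> ?R \<rightarrow>\<^sub>M (\<Pi>\<^sub>M x\<in>X. borel)"
          proof (rule measurable_restrict)
            fix x assume "x \<in> X"
            then have [measurable]: "x \<in> space \<mu>" by (simp add: space_\<mu>)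
            show "(\<lambda>\<omega>. f x (?gdg \<omega> T)) \<in> borel_measurable ?R"
              by measurable
          qed
        qed
        also have "\<dots> = distr ?R (\<Pi>\<^sub>M x\<in>space \<mu>. borel) (\<lambda>\<omega>. \<lambda>x\<in>space \<mu>. f (act ?i x) (?gdg \<omega> T))"
          by (intro distr_cong) (auto simp: space_\<mu> in_X)
        finally show ?thesis
          by (simp only: gd_algorithm_def space_\<mu>)
      qed
      \<comment> \<open>A change of variables by \<open>g\<close> removes the inverse that
        equivariance put into the model and moves it onto the target.\<close>
      have shift: "(\<integral>\<^sup>+x. ennreal ((f (act ?i x) \<theta> - h x)\<^sup>2) \<partial>\<mu>) =
          (\<integral>\<^sup>+x. ennreal ((f x \<theta> - ?hg g x)\<^sup>2) \<partial>\<mu>)" for \<theta>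
      proof -
        have "(\<integral>\<^sup>+x. ennreal ((f x \<theta> - ?hg g x)\<^sup>2) \<partial>\<mu>) =
            (\<integral>\<^sup>+x. ennreal ((f (act ?i (act g x)) \<theta> - h (act g x))\<^sup>2) \<partial>\<mu>)"
          by (intro nn_integral_cong) (simp add: i_g space_\<mu>)
        also have "\<dots> = (\<integral>\<^sup>+x. ennreal ((f (act ?i x) \<theta> - h x)\<^sup>2) \<partial>\<mu>)"
          by (rule invariant[OF g, of "\<lambda>x. ennreal ((f (act ?i x) \<theta> - h x)\<^sup>2)"]) measurable
        finally show ?thesis
          by (rule sym)
      qed
      \<comment> \<open>The two processes have equal laws, so the squared loss against the same
        \<open>h\<close> may be compared; the target becomes \<open>h \<circ> g\<close> only through
        \<open>shift\<close>.\<close>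
      have "measure ?R {\<omega> \<in> space ?R. (\<integral>\<^sup>+x. ennreal ((f x (?gd \<omega> T) - h x)\<^sup>2) \<partial>\<mu>) \<le> ennreal c} =
          measure ?R {\<omega> \<in> space ?R. (\<integral>\<^sup>+x. ennreal ((f (act ?i x) (?gdg \<omega> T) - h x)\<^sup>2) \<partial>\<mu>) \<le> ennreal c}"
        by (rule equal_law_imp_equal_integral_law[OF assms(1) R.prob_space_axioms R.prob_space_axioms _ _ law,
              where \<Phi> = "\<lambda>x y. (y - h x)\<^sup>2"])
           (use True in measurable)
      then show ?thesis
        by (simp only: shift)
    qed
    show ?thesis
      unfolding c_def[symmetric] event
      by (rule averaged_learning_bound[OF assms(9,10,8,19,20,21) True margin eq_refl[OF same]])
  qed
qed

end
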